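(* Let $\Omega$ be an open set in $\mathbb R^n$, $n\geq2$, such that $\mathcal L^n(\Omega)<\infty$ and $\mathcal H^{n-1}(\partial\Omega)<\infty$. If $p>n$, then there exists a constant $C=C(n,p,\mathcal L^n(\Omega),\mathcal H^{n-1}(\partial\Omega))$ such that $$\|\mathbf u\|_{L^\infty(\Omega)}\leq C\Big(\|\mathcal E\mathbf u\|_{L^p(\Omega)}+\|\mathbf u\|_{L^\infty(\partial\Omega)}\Big)$$ for every $\mathbf u\in E^{1,p}(\Omega)\cap C_b(\overline\Omega)$.
   Context: Functions $\mathbf u$ are $\mathbb R^n$-valued. $\mathcal E\mathbf u=\tfrac12(\nabla\mathbf u+(\nabla\mathbf u)^T)$ is the symmetric part of the distributional gradient. $E^{1,p}(\Omega)=\{\mathbf u\in L^1_{\rm loc}(\Omega):|\mathcal E\mathbf u|\in L^p(\Omega)\}$. $C_b(\overline\Omega)$ is the set of functions that are continuous in $\overline\Omega$ and have bounded support. $\mathcal L^n$ is Lebesgue measure and $\mathcal H^{n-1}$ the $(n-1)$-dimensional Hausdorff measure. Norms over $\Omega$ are with respect to $\mathcal L^n$; norms over $\partial\Omega$ are with respect to $\mathcal H^{n-1}$ and are applied to the restriction of $\mathbf u$ to $\partial\Omega$. *)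

theory Defs
  imports "HOL-Analysis.Analysis" "HOL-Probability.Essential_Supremum"
begin

section \<open>Hausdorff measure\<close>

text \<open>
  The Hausdorff measure of integer dimension \<open>k\<close> is taken as an outer measure, defined on all
  subsets of a metric space. It is normalised so that on \<open>k\<close>-dimensional Euclidean space it is
  Lebesgue measure. The empty set is treated separately because \<open>0 ^ 0 = 1\<close>, and covering sets
  are required to be bounded because the library's \<open>diameter\<close> is unspecified otherwise.
\<close>

definition hausdorff_gauge :: "nat \<Rightarrow> 'a::metric_space set \<Rightarrow> ennreal" where
  "hausdorff_gauge k S =
     (if S = {} then 0 else ennreal (unit_ball_vol (real k) * (diameter S / 2) ^ k))"

definition hausdorff_content :: "nat \<Rightarrow> real \<Rightarrow> 'a::metric_space set \<Rightarrow> ennreal" where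
  "hausdorff_content k \<delta> A =
     (INF S \<in> {S :: nat \<Rightarrow> 'a set. A \<subseteq> (\<Union>i. S i) \<and> (\<forall>i. bounded (S i) \<and> diameter (S i) \<le> \<delta>)}.
        (\<Sum>i. hausdorff_gauge k (S i)))"

definition hausdorff_measure :: "nat \<Rightarrow> 'a::metric_space set \<Rightarrow> ennreal" where
  "hausdorff_measure k A = (SUP \<delta> \<in> {0<..}. hausdorff_content k \<delta> A)"


section \<open>Norms\<close>

definition Lp_norm :: "real \<Rightarrow> 'a::euclidean_space set \<Rightarrow> ('a \<Rightarrow> 'b::real_normed_vector) \<Rightarrow> ennreal" where
  "Lp_norm p \<Omega> f =
     (let I = (\<integral>\<^sup>+x. ennreal (norm (f x) powr p) \<partial>lebesgue_on \<Omega>)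
      in if I = \<infinity> then \<infinity> else ennreal (enn2real I powr (1 / p)))"

definition Linf_norm :: "'a::euclidean_space set \<Rightarrow> ('a \<Rightarrow> 'b::real_normed_vector) \<Rightarrow> ennreal" where
  "Linf_norm \<Omega> f = esssup (lebesgue_on \<Omega>) (\<lambda>x. ennreal (norm (f x)))"

text \<open>The essential supremum of \<open>norm f\<close> over \<open>A\<close> with respect to \<open>k\<close>-dimensional Hausdorff measure;
  compare \<open>esssup_eq\<close>.\<close>

definition Linf_norm_hausdorff ::
    "nat \<Rightarrow> 'a::metric_space set \<Rightarrow> ('a \<Rightarrow> 'b::real_normed_vector) \<Rightarrow> ennreal" where
  "Linf_norm_hausdorff k A f = Inf {z. hausdorff_measure k {x \<in> A. ennreal (norm (f x)) > z} = 0}"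


section \<open>Test functions\<close>

definition partial_deriv :: "'n::finite \<Rightarrow> (real^'n \<Rightarrow> real) \<Rightarrow> real^'n \<Rightarrow> real" where
  "partial_deriv j \<phi> x = frechet_derivative \<phi> (at x) (axis j 1)"

primrec Ck_function :: "nat \<Rightarrow> (real^'n::finite \<Rightarrow> real) \<Rightarrow> bool" where
  "Ck_function 0 \<phi> \<longleftrightarrow> continuous_on UNIV \<phi>"
| "Ck_function (Suc k) \<phi> \<longleftrightarrow>
     (\<forall>x. \<phi> differentiable (at x)) \<and> (\<forall>j. Ck_function k (partial_deriv j \<phi>))"

definition test_functions :: "(real^'n::finite) set \<Rightarrow> (real^'n \<Rightarrow> real) set" where
  "test_functions \<Omega> =
     {\<phi>. (\<forall>k. Ck_function k \<phi>) \<and> compact (closure {x. \<phi> x \<noteq> 0}) \<and> closure {x. \<phi> x \<noteq> 0} \<subseteq> \<Omega>}"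


section \<open>Distributional symmetric gradient\<close>

definition L1_loc :: "'a::euclidean_space set \<Rightarrow> ('a \<Rightarrow> 'b::euclidean_space) set" where
  "L1_loc \<Omega> = {f. \<forall>K. compact K \<and> K \<subseteq> \<Omega> \<longrightarrow> f absolutely_integrable_on K}"

text \<open>The distributions below are matrix-valued; entry \<open>(i, j)\<close> of the gradient is the \<open>j\<close>-th
  partial derivative of the \<open>i\<close>-th component.\<close>

definition dist_grad ::
    "(real^'n::finite) set \<Rightarrow> (real^'n \<Rightarrow> real^'n) \<Rightarrow> (real^'n \<Rightarrow> real) \<Rightarrow> real^'n^'n" where
  "dist_grad \<Omega> u \<phi> = (\<chi> i j. - (LINT x:\<Omega>|lebesgue. u x $ i * partial_deriv j \<phi> x))"

definition dist_sym_grad ::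
    "(real^'n::finite) set \<Rightarrow> (real^'n \<Rightarrow> real^'n) \<Rightarrow> (real^'n \<Rightarrow> real) \<Rightarrow> real^'n^'n" where
  "dist_sym_grad \<Omega> u \<phi> = (1 / 2) *\<^sub>R (dist_grad \<Omega> u \<phi> + transpose (dist_grad \<Omega> u \<phi>))"

text \<open>The function \<open>E\<close> represents the distributional symmetric gradient of \<open>u\<close>; such a function
  is unique up to null sets.\<close>

definition is_sym_grad ::
    "(real^'n::finite) set \<Rightarrow> (real^'n \<Rightarrow> real^'n) \<Rightarrow> (real^'n \<Rightarrow> real^'n^'n) \<Rightarrow> bool" where
  "is_sym_grad \<Omega> u E \<longleftrightarrow> E \<in> L1_loc \<Omega> \<and>
     (\<forall>\<phi> \<in> test_functions \<Omega>. (LINT x:\<Omega>|lebesgue. \<phi> x *\<^sub>R E x) = dist_sym_grad \<Omega> u \<phi>)"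

text \<open>The norm on \<open>real^'n^'n\<close> is the Frobenius norm.\<close>

definition E1p :: "real \<Rightarrow> (real^'n::finite) set \<Rightarrow> (real^'n \<Rightarrow> real^'n) set" where
  "E1p p \<Omega> = {u \<in> L1_loc \<Omega>. \<exists>E. is_sym_grad \<Omega> u E \<and> Lp_norm p \<Omega> E < \<infinity>}"

definition Cb :: "'a::metric_space set \<Rightarrow> ('a \<Rightarrow> 'b::real_normed_vector) set" where
  "Cb S = {u. continuous_on S u \<and> bounded {x \<in> S. u x \<noteq> 0}}"

end

theory Submission
  imports Defs
begin

text \<open>
  Along a ray \<open>x + t z\<close> the scalar \<open>z \<bullet> u\<close> has derivative \<open>z \<bullet> (E z)\<close>, so only the symmetric part of
  the gradient enters: \<open>\<bar>z \<bullet> u x\<bar>\<close> is at most the size of \<open>u\<close> where the ray leaves \<open>\<Omega>\<close> (or the support of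
  \<open>u\<close>) plus the integral of \<open>norm E\<close> along the ray. The rays that leave through an \<open>(n-1)\<close>-dimensional
  null set form a Lebesgue-null cone. Averaging over \<open>z\<close> in the unit ball controls \<open>norm (u x)\<close>. At time
  \<open>t\<close> the average of \<open>norm E\<close> over the dilated ball is of order \<open>t powr (- n / p)\<close> because \<open>E\<close> is in
  \<open>L\<^sup>p\<close>, integrable at \<open>0\<close> since \<open>p > n\<close>, and of order \<open>t powr (- n)\<close> because \<open>\<Omega>\<close> has finite measure,
  integrable at infinity since \<open>n \<ge> 2\<close>. The derivative along rays is made sense of by mollifying \<open>u\<close>;
  as the bound on the averages is uniform in the mollification parameter, Fatou's lemma suffices for the
  limit.
\<close>

section \<open>Smooth bump functions and mollifiers\<close>

definition flat :: "real poly \<Rightarrow> real \<Rightarrow> real" where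
  "flat P t = (if t > 0 then poly P (1 / t) * exp (- (1 / t)) else 0)"

lemma poly_times_exp_minus_tendsto_0: "((\<lambda>x. poly P x * exp (- x)) \<longlongrightarrow> (0::real)) at_top"
proof -
  have "((\<lambda>x. \<Sum>i\<le>degree P. coeff P i * (x ^ i / exp x)) \<longlongrightarrow> (\<Sum>i\<le>degree P. coeff P i * 0)) at_top"
    by (intro tendsto_intros tendsto_power_div_exp_0)
  then show ?thesis
    by (simp add: poly_altdef sum_distrib_right exp_minus divide_inverse mult.assoc)
qed

lemma flat_tendsto_0: "(flat P \<longlongrightarrow> 0) (at 0)"
proof -
  have "((\<lambda>t. poly P (1 / t) * exp (- (1 / t))) \<longlongrightarrow> 0) (at_right 0)"
    using filterlim_compose[OF poly_times_exp_minus_tendsto_0 filterlim_inverse_at_top_right, of P]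
    by (simp add: inverse_eq_divide)
  then have "(flat P \<longlongrightarrow> 0) (at_right 0)"
    by (rule Lim_transform_eventually) (auto simp: flat_def eventually_at_right_less intro!: eventually_at_rightI[of 0 1])
  moreover have "(flat P \<longlongrightarrow> 0) (at_left 0)"
    by (rule tendsto_eventually) (auto simp: flat_def intro!: eventually_at_leftI[of "-1" 0])
  ultimately show ?thesis by (simp add: filterlim_split_at_real filterlim_split_at)
qed

text \<open>Differentiating P(1/t) exp(-1/t) gives (1/t^2) (P - P')(1/t) exp(-1/t). Carrying a
  general polynomial \<open>P\<close> is what closes the family under differentiation.\<close>

abbreviation flat_deriv :: "real poly \<Rightarrow> real poly" where
  "flat_deriv P \<equiv> monom 1 2 * (P - pderiv P)"

lemma flat_has_real_derivative: "(flat P has_real_derivative flat (flat_deriv P) t) (at t)"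
proof (cases t "0::real" rule: linorder_cases)
  case less
  have "((\<lambda>_. 0) has_real_derivative 0) (at t)" by simp
  then have "(flat P has_real_derivative 0) (at t)"
    by (rule DERIV_cong_ev[THEN iffD1, rotated -1])
      (use less eventually_nhds_in_open[of "{..<0}" t] in \<open>auto simp: flat_def elim!: eventually_mono\<close>)
  then show ?thesis using less by (simp add: flat_def)
next
  case equal
  \<comment> \<open>Division by h multiplies the polynomial by its variable 1/h, so the difference
    quotient at 0 is again in the family and tends to 0.\<close>
  have "flat (pCons 0 P) h = flat P h / h" for h
    by (simp add: flat_def)
  then have "(\<lambda>h. (flat P (0 + h) - flat P 0) / h) = flat (pCons 0 P)"
    by (auto simp: flat_def[of _ 0])
  then have "((\<lambda>h. (flat P (0 + h) - flat P 0) / h) \<longlongrightarrow> 0) (at 0)"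
    using flat_tendsto_0[of "pCons 0 P"] by metis
  then have "(flat P has_real_derivative 0) (at 0)" by (simp add: DERIV_def)
  then show ?thesis using equal by (simp add: flat_def)
next
  case greater
  have "((\<lambda>t. poly P (1 / t) * exp (- (1 / t))) has_real_derivative flat (flat_deriv P) t) (at t)"
    using greater
    by (auto intro!: derivative_eq_intros
        simp: flat_def poly_monom field_simps power2_eq_square)
  then show ?thesis
    by (rule DERIV_cong_ev[THEN iffD1, rotated -1])
      (use greater eventually_nhds_in_open[of "{0<..}" t] in \<open>auto simp: flat_def elim!: eventually_mono\<close>)
qed

lemma continuous_on_flat: "continuous_on S (flat P)"
  by (meson DERIV_isCont continuous_at_imp_continuous_on flat_has_real_derivative)

lemma continuous_on_flat_compose [continuous_intros]:
  "continuous_on S f \<Longrightarrow> continuous_on S (\<lambda>x. flat P (f x))"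
  using continuous_on_compose2[OF continuous_on_flat[of UNIV]] by blast

lemma flat_sphere_has_derivative:
  fixes a y :: "'a::real_inner"
  shows "((\<lambda>y. flat P (r - (y - a) \<bullet> (y - a))) has_derivative
     (\<lambda>h. flat (flat_deriv P) (r - (y - a) \<bullet> (y - a)) * (- 2 * ((y - a) \<bullet> h)))) (at y)"
proof -
  have "((\<lambda>y. r - (y - a) \<bullet> (y - a)) has_derivative (\<lambda>h. - 2 * ((y - a) \<bullet> h))) (at y)"
    by (auto intro!: derivative_eq_intros simp: inner_commute)
  from has_derivative_compose[OF this has_field_derivative_imp_has_derivative[OF flat_has_real_derivative]]
  show ?thesis by (simp add: algebra_simps)
qed

section \<open>An algebra of smooth functions closed under partial derivatives\<close>

inductive_set bump_algebra :: "real \<Rightarrow> real^'n \<Rightarrow> (real^'n \<Rightarrow> real) set" for r a where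
  flat: "(\<lambda>y. flat P (r - (y - a) \<bullet> (y - a))) \<in> bump_algebra r a"
| linear: "(\<lambda>y. c * ((y - a) \<bullet> v)) \<in> bump_algebra r a"
| const: "(\<lambda>y. c) \<in> bump_algebra r a"
| add: "f \<in> bump_algebra r a \<Longrightarrow> g \<in> bump_algebra r a \<Longrightarrow> (\<lambda>y. f y + g y) \<in> bump_algebra r a"
| mult: "f \<in> bump_algebra r a \<Longrightarrow> g \<in> bump_algebra r a \<Longrightarrow> (\<lambda>y. f y * g y) \<in> bump_algebra r a"

text \<open>The derivative of the radial generator is another radial generator times a linear
  factor, which is why linear functions and products are in the algebra. Closure in each fixed
  direction is the induction step for smoothness of every order.\<close>

lemma bump_algebra_has_derivative:
  assumes "f \<in> bump_algebra r a"
  shows "\<exists>D. (\<forall>y. (f has_derivative D y) (at y)) \<and> (\<forall>v. (\<lambda>y. D y v) \<in> bump_algebra r a)"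
  using assms
proof induction
  case (flat P)
  show ?case
    by (intro exI[of _ "\<lambda>y h. flat (flat_deriv P) (r - (y - a) \<bullet> (y - a)) * (- 2 * ((y - a) \<bullet> h))"]
        conjI allI flat_sphere_has_derivative bump_algebra.intros)
next
  case (linear c v)
  show ?case
    by (rule exI[of _ "\<lambda>y h. c * (h \<bullet> v)"])
      (auto intro!: derivative_eq_intros bump_algebra.intros)
next
  case (const c)
  show ?case
    by (rule exI[of _ "\<lambda>y h. 0"]) (auto intro!: derivative_eq_intros bump_algebra.intros)
next
  case (add f g)
  then obtain D D' where "\<And>y. (f has_derivative D y) (at y)" "\<And>y. (g has_derivative D' y) (at y)"
    "\<And>v. (\<lambda>y. D y v) \<in> bump_algebra r a" "\<And>v. (\<lambda>y. D' y v) \<in> bump_algebra r a" by metis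
  then show ?case
    by (intro exI[of _ "\<lambda>y h. D y h + D' y h"]) (auto intro!: has_derivative_add bump_algebra.intros)
next
  case (mult f g)
  then obtain D D' where "\<And>y. (f has_derivative D y) (at y)" "\<And>y. (g has_derivative D' y) (at y)"
    "\<And>v. (\<lambda>y. D y v) \<in> bump_algebra r a" "\<And>v. (\<lambda>y. D' y v) \<in> bump_algebra r a" by metis
  with mult.hyps show ?case
    by (intro exI[of _ "\<lambda>y h. f y * D' y h + D y h * g y"]) (auto intro!: has_derivative_mult bump_algebra.intros)
qed

lemma bump_algebra_differentiable:
  assumes "f \<in> bump_algebra r a"
  shows "f differentiable (at y)" "partial_deriv j f \<in> bump_algebra r a"
proof -
  obtain D where D: "\<And>y. (f has_derivative D y) (at y)" "\<And>v. (\<lambda>y. D y v) \<in> bump_algebra r a"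
    using bump_algebra_has_derivative[OF assms] by metis
  show "f differentiable (at y)" using D(1) by (auto simp: differentiable_def)
  have "partial_deriv j f = (\<lambda>y. D y (axis j 1))"
    unfolding partial_deriv_def using frechet_derivative_at[OF D(1)] by auto
  then show "partial_deriv j f \<in> bump_algebra r a" using D(2) by simp
qed

lemma bump_algebra_Ck: "f \<in> bump_algebra r a \<Longrightarrow> Ck_function k f"
proof (induction k arbitrary: f)
  case 0
  then show ?case
    using bump_algebra_differentiable(1)
    by (auto intro!: continuous_at_imp_continuous_on differentiable_imp_continuous_within)
next
  case (Suc k)
  then show ?case by (auto intro: bump_algebra_differentiable)
qed

section \<open>Normalised bump functions and their derivatives\<close>

definition bump :: "real \<Rightarrow> 'a::euclidean_space \<Rightarrow> real" where
  "bump e y = flat 1 (e\<^sup>2 - y \<bullet> y)"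

definition mollifier :: "real \<Rightarrow> 'a::euclidean_space \<Rightarrow> real" where
  "mollifier e y = bump e y / integral\<^sup>L lborel (bump e :: 'a \<Rightarrow> real)"

lemma continuous_on_bump: "continuous_on S (bump e)"
  unfolding bump_def by (intro continuous_intros)

lemma bump_nonneg: "bump e y \<ge> 0"
  by (simp add: bump_def flat_def)

lemma bump_pos_iff: 
  assumes "e > 0" shows "bump e y > 0 \<longleftrightarrow> norm y < e"
proof -
  have "e\<^sup>2 - y \<bullet> y > 0 \<longleftrightarrow> norm y < e"
    using assms by (simp add: norm_lt_square inner_commute)
  then show ?thesis by (simp add: bump_def flat_def)
qed

lemma bump_eq_0: "e > 0 \<Longrightarrow> norm y \<ge> e \<Longrightarrow> bump e y = 0"
  using bump_pos_iff[of e y] bump_nonneg[of e y] by linarith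

lemma integrable_bump:
  assumes "e > 0" shows "integrable lborel (bump e :: 'a::euclidean_space \<Rightarrow> real)"
proof -
  have "integrable lborel (\<lambda>y::'a. indicator (cball 0 e) y *\<^sub>R bump e y)"
    using borel_integrable_compact[OF compact_cball continuous_on_bump, of 0 e e]
    by (simp only: set_integrable_def)
  moreover have "indicator (cball 0 e) y *\<^sub>R bump e y = bump e y" for y :: 'a
    using bump_eq_0[OF assms, of y] by (auto simp: indicator_def)
  ultimately show ?thesis by (simp only:)
qed

text \<open>Otherwise the bump would vanish almost everywhere, although it is positive on a ball of
  positive measure.\<close>

lemma integral_bump_pos:
  assumes "e > 0" shows "integral\<^sup>L lborel (bump e :: 'a::euclidean_space \<Rightarrow> real) > 0"
proof -
  have "integral\<^sup>L lborel (bump e :: 'a \<Rightarrow> real) \<noteq> 0"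
  proof
    assume "integral\<^sup>L lborel (bump e :: 'a \<Rightarrow> real) = 0"
    then have "AE y in lborel. bump e (y::'a) = 0"
      using integral_nonneg_eq_0_iff_AE[OF integrable_bump[OF assms]] bump_nonneg by auto
    then have "AE y::'a in lborel. y \<notin> ball 0 e"
      by (rule AE_mp) (use bump_pos_iff[OF assms] in \<open>force intro!: AE_I2\<close>)
    then have "emeasure lborel (ball (0::'a) e) = 0"
      by (subst (asm) AE_iff_measurable[of "ball 0 e"]) auto
    then show False
      using emeasure_lborel_ball_finite assms unit_ball_vol_pos[of "DIM('a)"] by (simp add: emeasure_ball)
  qed
  moreover have "integral\<^sup>L lborel (bump e :: 'a \<Rightarrow> real) \<ge> 0"
    by (intro Bochner_Integration.integral_nonneg bump_nonneg)
  ultimately show ?thesis by linarith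
qed

lemma mollifier_nonneg: "mollifier e y \<ge> 0"
  unfolding mollifier_def by (intro divide_nonneg_nonneg Bochner_Integration.integral_nonneg bump_nonneg)

lemma mollifier_eq_0: "e > 0 \<Longrightarrow> norm y \<ge> e \<Longrightarrow> mollifier e y = 0"
  by (simp add: mollifier_def bump_eq_0)

lemma continuous_on_mollifier: "continuous_on S (mollifier e)"
  unfolding mollifier_def divide_inverse by (intro continuous_intros continuous_on_bump)

lemma borel_measurable_mollifier [measurable]: "mollifier e \<in> borel_measurable borel"
  by (rule borel_measurable_continuous_onI[OF continuous_on_mollifier])

lemma nn_integral_mollifier:
  assumes "e > 0" shows "(\<integral>\<^sup>+ (y::'a::euclidean_space). ennreal (mollifier e y) \<partial>lborel) = 1"
proof -
  have "integrable lborel (mollifier e :: 'a \<Rightarrow> real)"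
    unfolding mollifier_def by (intro integrable_divide integrable_bump assms)
  then have "(\<integral>\<^sup>+ (y::'a). ennreal (mollifier e y) \<partial>lborel) = ennreal (integral\<^sup>L lborel (mollifier e :: 'a \<Rightarrow> real))"
    by (rule nn_integral_eq_integral) (simp add: mollifier_nonneg)
  also have "integral\<^sup>L lborel (mollifier e :: 'a \<Rightarrow> real) = 1"
    unfolding mollifier_def using integral_bump_pos[OF assms, where 'a='a] by simp
  finally show ?thesis by simp
qed

text \<open>In this closed form, linearity in \<open>h\<close>, vanishing outside the ball of radius
  \<open>e\<close> and joint continuity in point and direction can be read off. Joint continuity is
  what differentiation under the integral sign uses.\<close>

definition mollifier_deriv :: "real \<Rightarrow> 'a::euclidean_space \<Rightarrow> 'a \<Rightarrow> real" where
  "mollifier_deriv e y h =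
     flat (flat_deriv 1) (e\<^sup>2 - y \<bullet> y) * (- 2 * (y \<bullet> h)) / integral\<^sup>L lborel (bump e :: 'a \<Rightarrow> real)"

lemma mollifier_has_derivative: "(mollifier e has_derivative mollifier_deriv e y) (at y)"
proof -
  have "(bump e has_derivative
      (\<lambda>h. flat (flat_deriv 1) (e\<^sup>2 - y \<bullet> y) * (- 2 * (y \<bullet> h)))) (at y)"
    using flat_sphere_has_derivative[of 1 "e\<^sup>2" 0] unfolding bump_def by simp
  from has_derivative_mult_left[OF this] show ?thesis
    unfolding mollifier_def mollifier_deriv_def divide_inverse .
qed

lemma mollifier_deriv_eq_0: "e > 0 \<Longrightarrow> norm y \<ge> e \<Longrightarrow> mollifier_deriv e y h = 0"
proof -
  assume "e > 0" "norm y \<ge> e"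
  then have "\<not> e\<^sup>2 - y \<bullet> y > 0" by (metis diff_gt_0_iff_gt norm_lt_square not_le)
  then show ?thesis by (simp add: mollifier_deriv_def flat_def)
qed

lemma continuous_on_mollifier_deriv [continuous_intros]:
  "continuous_on S f \<Longrightarrow> continuous_on S g \<Longrightarrow> continuous_on S (\<lambda>x. mollifier_deriv e (f x) (g x))"
  unfolding mollifier_deriv_def divide_inverse by (intro continuous_intros)

text \<open>Since \<open>bump\<close> involves the squared norm, which is smooth at the centre too,
  the shifted mollifier lies in \<open>bump_algebra\<close>; division by the integral is
  multiplication by a constant.\<close>

lemma mollifier_shift_test_function:
  fixes a :: "real^'n"
  assumes "e > 0" "cball a e \<subseteq> \<Omega>"
  shows "(\<lambda>y. mollifier e (y - a)) \<in> test_functions \<Omega>"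
proof -
  have "(\<lambda>y. mollifier e (y - a)) \<in> bump_algebra (e\<^sup>2) a"
    unfolding mollifier_def bump_def divide_inverse
    by (intro bump_algebra.intros)
  moreover have "{y. mollifier e (y - a) \<noteq> 0} \<subseteq> cball a e"
    using mollifier_eq_0[OF assms(1)] by (force simp: dist_norm norm_minus_commute)
  then have "closure {y. mollifier e (y - a) \<noteq> 0} \<subseteq> cball a e"
    by (simp add: closure_minimal)
  moreover from this have "compact (closure {y. mollifier e (y - a) \<noteq> 0})"
    by (meson bounded_cball bounded_subset closed_closure compact_eq_bounded_closed)
  ultimately show ?thesis
    using assms(2) bump_algebra_Ck unfolding test_functions_def by blast
qed

lemma partial_deriv_mollifier_shift:
  "partial_deriv j (\<lambda>y. mollifier e (y - a)) y = mollifier_deriv e (y - a) (axis j 1)"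
proof -
  have "((\<lambda>y. mollifier e (y - a)) has_derivative mollifier_deriv e (y - a)) (at y)"
    by (rule has_derivative_compose[OF _ mollifier_has_derivative, of "\<lambda>y. y - a" "\<lambda>h. h", simplified])
      (auto intro!: derivative_eq_intros)
  from frechet_derivative_at[OF this] show ?thesis unfolding partial_deriv_def by metis
qed

section \<open>Averages of integrals along rays\<close>

lemma nn_integral_lborel_affine:
  fixes f :: "'a::euclidean_space \<Rightarrow> ennreal"
  assumes [measurable]: "f \<in> borel_measurable borel" and "c \<noteq> 0"
  shows "(\<integral>\<^sup>+ x. f (t + c *\<^sub>R x) \<partial>lborel) = ennreal (1 / \<bar>c\<bar> ^ DIM('a)) * (\<integral>\<^sup>+ x. f x \<partial>lborel)"
proof -
  have "(\<integral>\<^sup>+ x. f x \<partial>lborel) = ennreal (\<bar>c\<bar> ^ DIM('a)) * (\<integral>\<^sup>+ x. f (t + c *\<^sub>R x) \<partial>lborel)"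
    by (subst lborel_affine[OF assms(2), of t])
      (simp add: nn_integral_density nn_integral_distr nn_integral_cmult)
  then show ?thesis
    using assms(2) by (simp add: mult.assoc[symmetric] ennreal_mult[symmetric])
qed

text \<open>The first part is unit mass in the point of integration, for averages; the second, by
  reflection, is unit mass in the centre, for Tonelli's theorem.\<close>

lemma nn_integral_mollifier_shift:
  fixes a :: "'a::euclidean_space"
  assumes "e > 0"
  shows "(\<integral>\<^sup>+ y. ennreal (mollifier e (y - a)) \<partial>lborel) = 1"
    and "(\<integral>\<^sup>+ y. ennreal (mollifier e (a - y)) \<partial>lborel) = 1"
  using nn_integral_lborel_affine[of "\<lambda>y::'a. ennreal (mollifier e y)" 1 "- a"]
    nn_integral_lborel_affine[of "\<lambda>y::'a. ennreal (mollifier e y)" "- 1" "a"]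
  by (simp_all add: nn_integral_mollifier[OF assms])

text \<open>As the mollifier is even, this is its convolution with the positive part of
  \<open>f\<close>. Values in \<open>ennreal\<close> make it exist without any integrability of
  \<open>f\<close>.\<close>

definition mollify :: "real \<Rightarrow> ('a::euclidean_space \<Rightarrow> real) \<Rightarrow> 'a \<Rightarrow> ennreal" where
  "mollify e f a = (\<integral>\<^sup>+ y. ennreal (mollifier e (y - a)) * ennreal (f y) \<partial>lborel)"

lemma borel_measurable_mollify [measurable]:
  assumes [measurable]: "f \<in> borel_measurable borel"
  shows "mollify e f \<in> borel_measurable borel"
  unfolding mollify_def by measurable

text \<open>Tonelli's theorem and unit mass in the centre variable; this keeps the later estimates
  uniform in \<open>e\<close>.\<close>

lemma nn_integral_mollify:
  fixes f :: "'a::euclidean_space \<Rightarrow> real"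
  assumes [measurable]: "f \<in> borel_measurable borel" and "e > 0"
  shows "(\<integral>\<^sup>+ a. mollify e f a \<partial>lborel) = (\<integral>\<^sup>+ y. ennreal (f y) \<partial>lborel)"
proof -
  have "(\<integral>\<^sup>+ a. mollify e f a \<partial>lborel)
      = (\<integral>\<^sup>+ y. (\<integral>\<^sup>+ a. ennreal (mollifier e (y - a)) * ennreal (f y) \<partial>lborel) \<partial>lborel)"
    unfolding mollify_def by (rule lborel_pair.Fubini') measurable
  then show ?thesis
    by (simp add: nn_integral_multc nn_integral_mollifier_shift[OF assms(2)])
qed

text \<open>Splitting at height \<open>s\<close> replaces the use of Hoelder's inequality.\<close>

lemma mollify_le_split:
  fixes f :: "'a::euclidean_space \<Rightarrow> real"
  assumes [measurable]: "f \<in> borel_measurable borel"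
    and f: "\<And>y. f y \<ge> 0" and "e > 0" "s > 0" "p > 1"
  shows "mollify e f a \<le> ennreal s + ennreal (s powr (1 - p)) * mollify e (\<lambda>y. f y powr p) a"
proof -
  \<comment> \<open>Above height \<open>s\<close>, write f = f^(1-p) f^p; as 1 - p is negative, the
    first factor is at most s^(1-p).\<close>
  have split: "f y \<le> s + s powr (1 - p) * f y powr p" for y
  proof (cases "f y \<le> s")
    case False
    then have "(s / f y) powr (1 - p) \<ge> (s / f y) powr 0"
      using \<open>s > 0\<close> \<open>p > 1\<close> by (intro powr_mono') auto
    then have "1 \<le> s powr (1 - p) / f y powr (1 - p)"
      using False \<open>s > 0\<close> by (simp add: powr_divide)
    then have "f y powr (1 - p) \<le> s powr (1 - p)"
      using False \<open>s > 0\<close> by (simp add: le_divide_eq)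
    then have "f y powr (1 - p) * f y powr p \<le> s powr (1 - p) * f y powr p"
      by (intro mult_right_mono) auto
    moreover have "f y powr (1 - p) * f y powr p = f y"
      using False \<open>s > 0\<close> by (simp add: powr_add[symmetric])
    ultimately show ?thesis using \<open>s > 0\<close> by linarith
  qed (use \<open>s > 0\<close> in \<open>simp add: add_increasing2\<close>)
  have "mollify e f a \<le> (\<integral>\<^sup>+ y. ennreal (mollifier e (y - a)) * ennreal s
      + ennreal (s powr (1 - p)) * (ennreal (mollifier e (y - a)) * ennreal (f y powr p)) \<partial>lborel)"
    unfolding mollify_def
  proof (rule nn_integral_mono)
    fix y
    have "ennreal (f y) \<le> ennreal s + ennreal (s powr (1 - p)) * ennreal (f y powr p)"
      using split[of y] \<open>s > 0\<close> by (simp flip: ennreal_mult ennreal_plus)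
    then have "ennreal (mollifier e (y - a)) * ennreal (f y)
        \<le> ennreal (mollifier e (y - a)) * (ennreal s + ennreal (s powr (1 - p)) * ennreal (f y powr p))"
      by (rule mult_left_mono) simp
    then show "ennreal (mollifier e (y - a)) * ennreal (f y) \<le> ennreal (mollifier e (y - a)) * ennreal s
      + ennreal (s powr (1 - p)) * (ennreal (mollifier e (y - a)) * ennreal (f y powr p))"
      by (simp add: distrib_left mult_ac)
  qed
  also have "\<dots> = ennreal s + ennreal (s powr (1 - p)) * mollify e (\<lambda>y. f y powr p) a"
    unfolding mollify_def
    by (simp add: nn_integral_add nn_integral_multc nn_integral_cmult nn_integral_mollifier_shift[OF \<open>e > 0\<close>])
  finally show ?thesis .
qed

text \<open>The direction \<open>z\<close> will range over the solid unit ball rather than the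
  sphere, so \<open>t\<close> is not arc length and no polar coordinates occur. Integrating over all
  positive times dominates every exit time, and the indicator of \<Omega> lets its finite measure
  control large times.\<close>

definition ray_potential ::
    "'a::euclidean_space set \<Rightarrow> real \<Rightarrow> ('a \<Rightarrow> real) \<Rightarrow> 'a \<Rightarrow> 'a \<Rightarrow> ennreal" where
  "ray_potential \<Omega> e f x z =
     (\<integral>\<^sup>+ t. indicator {0<..} t * (indicator \<Omega> (x + t *\<^sub>R z) * mollify e f (x + t *\<^sub>R z)) \<partial>lborel)"

lemma borel_measurable_ray_potential [measurable]:
  assumes [measurable]: "f \<in> borel_measurable borel" "\<Omega> \<in> sets borel"
  shows "ray_potential \<Omega> e f x \<in> borel_measurable borel"
  unfolding ray_potential_def by measurable

text \<open>The constant part of \<open>mollify_le_split\<close> is integrated over those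
  \<open>z\<close> in the unit ball with \<open>x + t *\<^sub>R z\<close> in \<Omega>, the other
  part over the whole space after the substitution y = x + tz. The height \<open>s\<close> stays
  free because small and large times need different choices.\<close>

lemma nn_integral_ray_potential_slice:
  fixes f :: "'a::euclidean_space \<Rightarrow> real"
  assumes [measurable]: "f \<in> borel_measurable borel" "\<Omega> \<in> sets borel"
    and f: "\<And>y. f y \<ge> 0" and "e > 0" "p > 1" "F > 0" "L \<ge> 0" "t > 0" "s > 0"
    and F: "(\<integral>\<^sup>+ y. ennreal (f y powr p) \<partial>lborel) \<le> ennreal (F powr p)"
    and L: "emeasure lborel \<Omega> \<le> ennreal L"
  shows "(\<integral>\<^sup>+ z. indicator (ball 0 1) z * (indicator \<Omega> (x + t *\<^sub>R z) * mollify e f (x + t *\<^sub>R z)) \<partial>lborel)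
    \<le> ennreal (s * min (unit_ball_vol DIM('a)) (L / t ^ DIM('a)) + s powr (1 - p) * (F powr p / t ^ DIM('a)))"
proof -
  let ?V = "\<integral>\<^sup>+ z. indicator (ball 0 1) z * indicator \<Omega> (x + t *\<^sub>R z) \<partial>lborel"
  have [measurable]: "ball (0::'a) 1 \<in> sets borel" by simp
  have [measurable]: "(\<lambda>z. indicator \<Omega> (x + t *\<^sub>R z) :: ennreal) \<in> borel_measurable borel"
    by (rule measurable_compose[OF _ borel_measurable_indicator[OF assms(2)]]) simp
  have measurable_slice:
    "(\<lambda>z. indicator (ball 0 1) z * indicator \<Omega> (x + t *\<^sub>R z) :: ennreal) \<in> borel_measurable lborel"
    "(\<lambda>z. ennreal s * (indicator (ball 0 1) z * indicator \<Omega> (x + t *\<^sub>R z))) \<in> borel_measurable lborel"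
    "(\<lambda>z. mollify e (\<lambda>y. f y powr p) (x + t *\<^sub>R z)) \<in> borel_measurable lborel"
    "(\<lambda>z. ennreal (s powr (1 - p)) * mollify e (\<lambda>y. f y powr p) (x + t *\<^sub>R z)) \<in> borel_measurable lborel"
    by simp_all
  have "(\<integral>\<^sup>+ z. indicator (ball 0 1) z * (indicator \<Omega> (x + t *\<^sub>R z) * mollify e f (x + t *\<^sub>R z)) \<partial>lborel)
    \<le> (\<integral>\<^sup>+ z. ennreal s * (indicator (ball 0 1) z * indicator \<Omega> (x + t *\<^sub>R z)) +
         ennreal (s powr (1 - p)) * mollify e (\<lambda>y. f y powr p) (x + t *\<^sub>R z) \<partial>lborel)"
  proof (rule nn_integral_mono)
    fix z
    show "indicator (ball 0 1) z * (indicator \<Omega> (x + t *\<^sub>R z) * mollify e f (x + t *\<^sub>R z))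
      \<le> ennreal s * (indicator (ball 0 1) z * indicator \<Omega> (x + t *\<^sub>R z)) +
         ennreal (s powr (1 - p)) * mollify e (\<lambda>y. f y powr p) (x + t *\<^sub>R z)"
      using mollify_le_split[OF assms(1) f \<open>e > 0\<close> \<open>s > 0\<close> \<open>p > 1\<close>, of "x + t *\<^sub>R z"]
      by (auto simp: indicator_def)
  qed
  also have "\<dots> = ennreal s * ?V + ennreal (s powr (1 - p)) *
      (\<integral>\<^sup>+ z. mollify e (\<lambda>y. f y powr p) (x + t *\<^sub>R z) \<partial>lborel)"
    by (simp only: nn_integral_add nn_integral_cmult measurable_slice)
  also have "\<dots> \<le> ennreal s * ennreal (min (unit_ball_vol DIM('a)) (L / t ^ DIM('a))) +
      ennreal (s powr (1 - p)) * ennreal (F powr p / t ^ DIM('a))"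
  proof (intro add_mono mult_left_mono)
    have "?V \<le> (\<integral>\<^sup>+ z. indicator (ball (0::'a) 1) z \<partial>lborel)"
      by (rule nn_integral_mono) (auto simp: indicator_def)
    also have "\<dots> = ennreal (unit_ball_vol DIM('a))"
      using emeasure_ball[of 1 "0::'a"] by simp
    finally have 1: "?V \<le> ennreal (unit_ball_vol DIM('a))" .
    have "?V \<le> (\<integral>\<^sup>+ z. indicator \<Omega> (x + t *\<^sub>R z) \<partial>lborel)"
      by (rule nn_integral_mono) (auto simp: indicator_def)
    also have "\<dots> = ennreal (1 / t ^ DIM('a)) * emeasure lborel \<Omega>"
      using \<open>t > 0\<close> by (subst nn_integral_lborel_affine) auto
    also have "\<dots> \<le> ennreal (1 / t ^ DIM('a)) * ennreal L"
      using L by (rule mult_left_mono) simp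
    also have "\<dots> = ennreal (L / t ^ DIM('a))"
      using \<open>t > 0\<close> \<open>L \<ge> 0\<close> by (simp flip: ennreal_mult)
    finally show "?V \<le> ennreal (min (unit_ball_vol DIM('a)) (L / t ^ DIM('a)))"
      using 1 by (simp add: min_def)
    have "(\<integral>\<^sup>+ z. mollify e (\<lambda>y. f y powr p) (x + t *\<^sub>R z) \<partial>lborel)
        = ennreal (1 / t ^ DIM('a)) * (\<integral>\<^sup>+ y. ennreal (f y powr p) \<partial>lborel)"
      using \<open>t > 0\<close> \<open>e > 0\<close> by (subst nn_integral_lborel_affine) (auto simp: nn_integral_mollify)
    also have "\<dots> \<le> ennreal (1 / t ^ DIM('a)) * ennreal (F powr p)"
      using F by (rule mult_left_mono) simp
    also have "\<dots> = ennreal (F powr p / t ^ DIM('a))"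
      using \<open>t > 0\<close> by (simp flip: ennreal_mult)
    finally show "(\<integral>\<^sup>+ z. mollify e (\<lambda>y. f y powr p) (x + t *\<^sub>R z) \<partial>lborel)
      \<le> ennreal (F powr p / t ^ DIM('a))" .
  qed auto
  also have "\<dots> = ennreal (s * min (unit_ball_vol DIM('a)) (L / t ^ DIM('a)) +
      s powr (1 - p) * (F powr p / t ^ DIM('a)))"
    using \<open>s > 0\<close> \<open>t > 0\<close> \<open>L \<ge> 0\<close>
    by (simp flip: ennreal_mult ennreal_plus)
  finally show ?thesis .
qed

text \<open>With b the volume of the unit ball, the summands are the integrals of (b + 1) t^(-n/p)
  over (0, 1] and of (L + 1) t^(-n) over [1, \<infinity>).\<close>

definition potential_const :: "nat \<Rightarrow> real \<Rightarrow> real \<Rightarrow> real" where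
  "potential_const n p L = (unit_ball_vol (real n) + 1) / (1 - real n / p) + (L + 1) / (real n - 1)"

text \<open>Tonelli's theorem moves the time integral outside, and each slice is estimated
  separately for times below and above 1. The bound depends neither on \<open>e\<close> nor on
  \<open>x\<close>.\<close>

lemma nn_integral_ray_potential:
  fixes f :: "'a::euclidean_space \<Rightarrow> real"
  assumes [measurable]: "f \<in> borel_measurable borel" "\<Omega> \<in> sets borel"
    and f: "\<And>y. f y \<ge> 0" and "e > 0" "p > real DIM('a)" "DIM('a) \<ge> 2" "F > 0" "L \<ge> 0"
    and F: "(\<integral>\<^sup>+ y. ennreal (f y powr p) \<partial>lborel) \<le> ennreal (F powr p)"
    and L: "emeasure lborel \<Omega> \<le> ennreal L"
  shows "(\<integral>\<^sup>+ z. indicator (ball 0 1) z * ray_potential \<Omega> e f x z \<partial>lborel)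
    \<le> ennreal (F * potential_const DIM('a) p L)"
proof -
  let ?n = "DIM('a)" and ?b = "unit_ball_vol DIM('a)"
  let ?J = "\<lambda>t. \<integral>\<^sup>+ z. indicator (ball 0 1) z * (indicator \<Omega> (x + t *\<^sub>R z) * mollify e f (x + t *\<^sub>R z)) \<partial>lborel"
  have p: "p > 1" "real ?n / p < 1" using \<open>p > ?n\<close> \<open>?n \<ge> 2\<close> by auto
  have small: "?J t \<le> ennreal (F * (?b + 1) * t powr (- (?n / p)))" if "t > 0" for t
  proof -
    \<comment> \<open>This height balances the two terms: s^(1-p) F^p t^(-n) = s. The resulting
      power t^(-n/p) is integrable at 0 because p > n.\<close>
    define s where "s = F * t powr (- (?n / p))"
    have "s > 0" using \<open>F > 0\<close> \<open>t > 0\<close> by (simp add: s_def)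
    have "s powr (1 - p) * (F powr p / t ^ ?n) = F powr (1 - p) * F powr p * (t powr (- (?n / p) * (1 - p)) * t powr (- real ?n))"
      using \<open>F > 0\<close> \<open>t > 0\<close> by (simp add: s_def powr_mult powr_powr powr_realpow powr_minus[of t "real DIM('a)"] divide_inverse)
    also have "\<dots> = s"
      using \<open>F > 0\<close> \<open>t > 0\<close> p unfolding powr_add[symmetric] by (simp add: s_def field_simps)
    finally have "s powr (1 - p) * (F powr p / t ^ ?n) = s" .
    then have "s * min ?b (L / t ^ ?n) + s powr (1 - p) * (F powr p / t ^ ?n) \<le> s * ?b + s"
      using \<open>s > 0\<close> by simp
    also have "\<dots> = F * (?b + 1) * t powr (- (?n / p))" by (simp add: s_def algebra_simps)
    finally show ?thesis
      using nn_integral_ray_potential_slice[OF assms(1,2) f \<open>e > 0\<close> p(1) \<open>F > 0\<close> \<open>L \<ge> 0\<close> \<open>t > 0\<close> \<open>s > 0\<close> F L]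
      by (meson ennreal_leI order_trans)
  qed
  \<comment> \<open>Here the height is \<open>F\<close> itself and the measure of \<Omega> enters:
    both terms become multiples of t^(-n), integrable at infinity because n \<ge> 2.\<close>
  have large: "?J t \<le> ennreal (F * (L + 1) * t powr (- real ?n))" if "t > 0" for t
  proof -
    have "F powr (1 - p) * (F powr p / t ^ ?n) = F / t ^ ?n"
      using \<open>F > 0\<close> by (simp add: powr_add[symmetric])
    moreover have "F * min ?b (L / t ^ ?n) \<le> F * (L / t ^ ?n)"
      using \<open>F > 0\<close> by (intro mult_left_mono) auto
    ultimately have "F * min ?b (L / t ^ ?n) + F powr (1 - p) * (F powr p / t ^ ?n)
        \<le> F * (L / t ^ ?n) + F / t ^ ?n"
      by linarith
    also have "\<dots> = F * (L + 1) * t powr (- real ?n)"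
      using \<open>t > 0\<close> by (simp add: powr_minus powr_realpow field_simps)
    finally show ?thesis
      using nn_integral_ray_potential_slice[OF assms(1,2) f \<open>e > 0\<close> p(1) \<open>F > 0\<close> \<open>L \<ge> 0\<close> \<open>t > 0\<close> \<open>F > 0\<close> F L]
      by (meson ennreal_leI order_trans)
  qed
  have [measurable]: "ball (0::'a) 1 \<in> sets borel" by simp
  have "(\<integral>\<^sup>+ z. indicator (ball 0 1) z * ray_potential \<Omega> e f x z \<partial>lborel)
      = (\<integral>\<^sup>+ z. (\<integral>\<^sup>+ t. indicator {0<..} t * (indicator (ball 0 1) z *
          (indicator \<Omega> (x + t *\<^sub>R z) * mollify e f (x + t *\<^sub>R z))) \<partial>lborel) \<partial>lborel)"
    unfolding ray_potential_def
    by (subst nn_integral_cmult[symmetric]) (auto simp: mult_ac)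
  also have "\<dots> = (\<integral>\<^sup>+ t. (\<integral>\<^sup>+ z. indicator {0<..} t * (indicator (ball 0 1) z *
          (indicator \<Omega> (x + t *\<^sub>R z) * mollify e f (x + t *\<^sub>R z))) \<partial>lborel) \<partial>lborel)"
    by (rule lborel_pair.Fubini') measurable
  also have "\<dots> = (\<integral>\<^sup>+ t. indicator {0<..} t * ?J t \<partial>lborel)"
    by (simp add: nn_integral_cmult)
  also have "\<dots> \<le> (\<integral>\<^sup>+ t. ennreal (F * (?b + 1) * t powr (- (?n / p))) * indicator {0..1} t
      + ennreal (F * (L + 1) * t powr (- real ?n)) * indicator {1..} t \<partial>lborel)"
  proof (rule nn_integral_mono)
    fix t :: real
    consider "t \<le> 0" | "0 < t" "t \<le> 1" | "t > 1" by linarith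
    then show "indicator {0<..} t * ?J t \<le> ennreal (F * (?b + 1) * t powr (- (?n / p))) * indicator {0..1} t
      + ennreal (F * (L + 1) * t powr (- real ?n)) * indicator {1..} t"
    proof cases
      case 2
      then show ?thesis using small[of t] by (simp add: add_increasing2)
    next
      case 3
      then show ?thesis using large[of t] by simp
    qed simp
  qed
  also have "\<dots> = (\<integral>\<^sup>+ t. ennreal (F * (?b + 1) * t powr (- (?n / p))) * indicator {0..1} t \<partial>lborel)
      + (\<integral>\<^sup>+ t. ennreal (F * (L + 1) * t powr (- real ?n)) * indicator {1..} t \<partial>lborel)"
    by (rule nn_integral_add) measurable
  also have "(\<integral>\<^sup>+ t. ennreal (F * (?b + 1) * t powr (- (?n / p))) * indicator {0..1} t \<partial>lborel)
      = ennreal (F * (?b + 1) * (1 / (1 - ?n / p)))"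
    using has_integral_mult_right[OF has_integral_powr_from_0[of "- (?n / p)" 1], of "F * (?b + 1)"] p \<open>F > 0\<close>
    by (intro nn_integral_has_integral_lebesgue') (auto simp: add_ac)
  also have "(\<integral>\<^sup>+ t. ennreal (F * (L + 1) * t powr (- real ?n)) * indicator {1..} t \<partial>lborel)
      = ennreal (F * (L + 1) * (1 / (real ?n - 1)))"
  proof (rule nn_integral_has_integral_lebesgue')
    have "- 1 / (- real ?n + 1) = 1 / (real ?n - 1)" using \<open>?n \<ge> 2\<close> by (simp add: field_simps)
    then show "((\<lambda>t. F * (L + 1) * t powr - real ?n) has_integral F * (L + 1) * (1 / (real ?n - 1))) {1..}"
      using has_integral_mult_right[OF has_integral_powr_to_inf[of "- ?n" 1], of "F * (L + 1)"] \<open>?n \<ge> 2\<close>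
      by simp
  qed (use \<open>F > 0\<close> \<open>L \<ge> 0\<close> in auto)
  also have "ennreal (F * (?b + 1) * (1 / (1 - ?n / p))) + ennreal (F * (L + 1) * (1 / (real ?n - 1)))
      = ennreal (F * potential_const ?n p L)"
    using \<open>F > 0\<close> \<open>L \<ge> 0\<close> p \<open>?n \<ge> 2\<close>
    by (simp add: potential_const_def algebra_simps flip: ennreal_plus)
  finally show ?thesis .
qed

section \<open>Cones over null sets of Hausdorff measure\<close>

lemma hausdorff_null_cover:
  fixes N :: "'a::metric_space set"
  assumes "hausdorff_measure k N = 0" "\<delta> > 0" "e > 0"
  obtains S :: "nat \<Rightarrow> 'a set" where "N \<subseteq> (\<Union>i. S i)"
    "\<And>i. bounded (S i)" "\<And>i. diameter (S i) \<le> \<delta>" "(\<Sum>i. hausdorff_gauge k (S i)) < ennreal e"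
proof -
  have "hausdorff_content k \<delta> N \<le> hausdorff_measure k N"
    unfolding hausdorff_measure_def using assms(2) by (intro SUP_upper) auto
  then have "hausdorff_content k \<delta> N < ennreal e" using assms by simp
  then show thesis
    unfolding hausdorff_content_def INF_less_iff using that by blast
qed

lemma hausdorff_measure_mono: "A \<subseteq> B \<Longrightarrow> hausdorff_measure k A \<le> hausdorff_measure k B"
  unfolding hausdorff_measure_def hausdorff_content_def
  by (intro SUP_mono' INF_superset_mono) auto

text \<open>Degenerate covering sets are given a small positive diameter, so that the number of pieces
  into which the cone over them is cut stays finite.\<close>

lemma hausdorff_null_cover_pos:
  fixes N :: "'a::metric_space set"
  assumes "hausdorff_measure k N = 0" "k \<ge> 1" "e > 0"
  obtains S :: "nat \<Rightarrow> 'a set" and d where "N \<subseteq> (\<Union>i. S i)"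
    "\<And>i x y. x \<in> S i \<Longrightarrow> y \<in> S i \<Longrightarrow> dist x y \<le> d i" "\<And>i. 0 < d i" "\<And>i. d i \<le> 1"
    "(\<Sum>i. ennreal (d i ^ k)) \<le> ennreal e"
proof -
  define c where "c = unit_ball_vol (real k) / 2 ^ k"
  have "c > 0" by (simp add: c_def)
  \<comment> \<open>Half of \<open>e\<close> is reserved for the sets of positive diameter, whose
    gauge is \<open>c\<close> times a power of the diameter; the other half goes to the degenerate
    sets.\<close>
  obtain S :: "nat \<Rightarrow> 'a set" where S: "N \<subseteq> (\<Union>i. S i)"
    "\<And>i. bounded (S i)" "\<And>i. diameter (S i) \<le> 1" "(\<Sum>i. hausdorff_gauge k (S i)) < ennreal (c * e / 2)"
    using hausdorff_null_cover[OF assms(1), of 1 "c * e / 2"] \<open>c > 0\<close> assms(3) by auto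
  \<comment> \<open>The geometric weights sum to e/2, and the cap at 1 ensures w^k \<le> w.\<close>
  define w where "w i = min 1 (e / 4 * (1 / 2) ^ i)" for i :: nat
  have w: "0 < w i" "w i \<le> 1" "w i \<le> e / 4 * (1 / 2) ^ i" for i
    using assms(3) by (auto simp: w_def)
  define d where "d i = (if S i = {} \<or> diameter (S i) = 0 then w i else diameter (S i))" for i
  have d_bound: "ennreal (d i ^ k) \<le> ennreal (1 / c) * hausdorff_gauge k (S i) + ennreal (e / 4 * (1 / 2) ^ i)" for i
  proof (cases "S i = {} \<or> diameter (S i) = 0")
    case True
    have "w i ^ k \<le> w i ^ 1" using w assms(2) by (intro power_decreasing) (auto simp: less_imp_le)
    then have "d i ^ k \<le> e / 4 * (1 / 2) ^ i" using True w(3)[of i] by (simp add: d_def)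
    then show ?thesis by (metis add_increasing ennreal_leI zero_le)
  next
    case False
    then have "ennreal (1 / c) * hausdorff_gauge k (S i)
        = ennreal (1 / c) * ennreal (c * diameter (S i) ^ k)"
      by (simp add: hausdorff_gauge_def c_def power_divide)
    also have "\<dots> = ennreal (d i ^ k)"
      using False \<open>c > 0\<close> diameter_ge_0[OF S(2)] by (simp add: d_def flip: ennreal_mult)
    finally have "ennreal (1 / c) * hausdorff_gauge k (S i) = ennreal (d i ^ k)" .
    then show ?thesis by simp
  qed
  have "(\<Sum>i. ennreal (d i ^ k)) \<le> (\<Sum>i. ennreal (1 / c) * hausdorff_gauge k (S i) + ennreal (e / 4 * (1 / 2) ^ i))"
    by (intro suminf_le d_bound summableI)
  also have "\<dots> = (\<Sum>i. ennreal (1 / c) * hausdorff_gauge k (S i)) + (\<Sum>i. ennreal (e / 4 * (1 / 2) ^ i))"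
    by (intro suminf_add[symmetric] summableI)
  also have "(\<Sum>i. ennreal (1 / c) * hausdorff_gauge k (S i)) = ennreal (1 / c) * (\<Sum>i. hausdorff_gauge k (S i))"
    by simp
  also have "\<dots> \<le> ennreal (1 / c) * ennreal (c * e / 2)"
    using S(4) by (intro mult_left_mono) auto
  also have "\<dots> = ennreal (e / 2)"
    using \<open>c > 0\<close> assms(3) by (simp flip: ennreal_mult)
  also have "(\<Sum>i. ennreal (e / 4 * (1 / 2) ^ i)) = ennreal (e / 2)"
  proof (rule suminf_ennreal_eq)
    show "(\<lambda>i. e / 4 * (1 / 2) ^ i) sums (e / 2)"
      using sums_mult[OF geometric_sums[of "1 / 2 :: real"], of "e / 4"] by simp
  qed (use assms(3) in auto)
  also have "ennreal (e / 2) + ennreal (e / 2) = ennreal e"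
    using assms(3) by (simp flip: ennreal_plus)
  finally have "(\<Sum>i. ennreal (d i ^ k)) \<le> ennreal e" by (simp add: add_mono)
  moreover have "dist x y \<le> d i" if "x \<in> S i" "y \<in> S i" for i x y
    using diameter_bounded_bound[OF S(2) that] w(1)[of i] that by (auto simp: d_def)
  moreover have "0 < d i" "d i \<le> 1" for i
    using w[of i] S(2,3)[of i] diameter_ge_0[OF S(2), of i] by (auto simp: d_def)
  ultimately show thesis using that S(1) by blast
qed

text \<open>This is a set of directions, with apex 0: for s > 0,
  \<open>z = s *\<^sub>R (y - x)\<close> says that the ray from \<open>x\<close> in direction
  \<open>z\<close> meets \<open>y\<close> at time 1/s. The bound \<open>c\<close> therefore excludes
  small times.\<close>

definition cone :: "'a::real_vector \<Rightarrow> real \<Rightarrow> 'a set \<Rightarrow> 'a set" where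
  "cone x c N = {s *\<^sub>R (y - x) | s y. 0 \<le> s \<and> s \<le> c \<and> y \<in> N}"

text \<open>The cone over a set of diameter at most \<open>d\<close> stays close to a segment, which
  is covered by about c/d balls of radius comparable to \<open>d\<close>. The number of balls costs
  one power of \<open>d\<close>, so the volume is of order d^(n-1).\<close>

lemma cone_small_cover:
  fixes x :: "'a::euclidean_space"
  assumes S: "\<And>y y'. y \<in> S \<Longrightarrow> y' \<in> S \<Longrightarrow> dist y y' \<le> d" and "S \<subseteq> cball x R"
    and "0 < d" "d \<le> 1" "c \<ge> 0" "R \<ge> 0"
  obtains T where "T \<in> sets lborel" "cone x c S \<subseteq> T"
    "emeasure lborel T \<le> ennreal (unit_ball_vol DIM('a) * (c + 1) * (R + c) ^ DIM('a) * d ^ (DIM('a) - 1))"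
proof (cases "S = {}")
  case True
  show thesis by (rule that[of "{}"]) (auto simp: True cone_def)
next
  case False
  then obtain y where y: "y \<in> S" by blast
  define m where "m = nat \<lfloor>c / d\<rfloor> + 1"
  define T where "T = (\<Union>j<m. cball ((j * d) *\<^sub>R (y - x)) ((R + c) * d))"
  have m: "m \<le> c / d + 1" "c / d < m"
    using \<open>0 < d\<close> \<open>c \<ge> 0\<close> by (auto simp: m_def) linarith
  show thesis
  proof
    show "T \<in> sets lborel" by (auto simp: T_def)
    show "cone x c S \<subseteq> T"
    proof
      fix v assume "v \<in> cone x c S"
      then obtain s z where v: "v = s *\<^sub>R (z - x)" "0 \<le> s" "s \<le> c" "z \<in> S" by (auto simp: cone_def)
      define j where "j = nat \<lfloor>s / d\<rfloor>"
      have j: "j * d \<le> s" "s \<le> j * d + d"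
      proof -
        have "real j \<le> s / d" "s / d \<le> real j + 1" using v(2) \<open>0 < d\<close> by (auto simp: j_def)
        then show "j * d \<le> s" "s \<le> j * d + d" using \<open>0 < d\<close> by (auto simp: field_simps)
      qed
      have "s / d \<le> c / d" using v(3) \<open>0 < d\<close> by (simp add: divide_right_mono)
      then have "j < m" unfolding j_def m_def by (simp add: floor_mono nat_mono less_Suc_eq_le)
      \<comment> \<open>Two errors make up the radius: replacing the point \<open>z\<close> by
        \<open>y\<close> costs at most c d, and rounding \<open>s\<close> down to a multiple of
        \<open>d\<close> costs at most d R.\<close>
      have "v - (j * d) *\<^sub>R (y - x) = s *\<^sub>R (z - y) + (s - j * d) *\<^sub>R (y - x)"
        by (simp add: v(1) algebra_simps)
      then have "norm (v - (j * d) *\<^sub>R (y - x)) \<le> norm (s *\<^sub>R (z - y)) + norm ((s - j * d) *\<^sub>R (y - x))"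
        by (metis norm_triangle_ineq)
      also have "\<dots> \<le> c * d + d * R"
      proof (rule add_mono)
        show "norm (s *\<^sub>R (z - y)) \<le> c * d"
          using S[OF v(4) y] v(2,3) by (auto simp: dist_norm intro!: mult_mono)
        have "norm (y - x) \<le> R" using y assms(2) by (auto simp: dist_norm norm_minus_commute)
        then show "norm ((s - j * d) *\<^sub>R (y - x)) \<le> d * R"
          using j \<open>0 < d\<close> by (auto intro!: mult_mono)
      qed
      finally have "v \<in> cball ((j * d) *\<^sub>R (y - x)) ((R + c) * d)"
        by (simp add: dist_norm norm_minus_commute algebra_simps)
      then show "v \<in> T" using \<open>j < m\<close> by (auto simp: T_def)
    qed
    have power_d: "d ^ DIM('a) = d * d ^ (DIM('a) - 1)"
      by (simp add: power_eq_if)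
    have "(c / d + 1) * d = c + d" using \<open>0 < d\<close> by (simp add: field_simps)
    then have simplified_bound: "(c / d + 1) * (unit_ball_vol DIM('a) * ((R + c) * d) ^ DIM('a))
        = unit_ball_vol DIM('a) * (c + d) * (R + c) ^ DIM('a) * d ^ (DIM('a) - 1)"
      unfolding power_mult_distrib power_d by (metis mult.assoc mult.commute)
    have "emeasure lborel T \<le> (\<Sum>j<m. emeasure lborel (cball ((j * d) *\<^sub>R (y - x)) ((R + c) * d)))"
      unfolding T_def by (rule emeasure_subadditive_finite) auto
    also have "\<dots> = ennreal (m * (unit_ball_vol DIM('a) * ((R + c) * d) ^ DIM('a)))"
      using \<open>0 < d\<close> assms by (simp add: emeasure_cball ennreal_of_nat_eq_real_of_nat flip: ennreal_mult)
    also have "\<dots> \<le> ennreal ((c / d + 1) * (unit_ball_vol DIM('a) * ((R + c) * d) ^ DIM('a)))"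
      using m assms by (intro ennreal_leI mult_right_mono) auto
    also have "\<dots> \<le> ennreal (unit_ball_vol DIM('a) * (c + 1) * (R + c) ^ DIM('a) * d ^ (DIM('a) - 1))"
      unfolding simplified_bound using assms by (intro ennreal_leI mult_right_mono mult_left_mono) auto
    finally show "emeasure lborel T \<le> ennreal (unit_ball_vol DIM('a) * (c + 1) * (R + c) ^ DIM('a) * d ^ (DIM('a) - 1))" .
  qed
qed

text \<open>The exponent n - 1 in the volume of a small cone matches the Hausdorff dimension, so
  summing over a fine cover of the null set gives arbitrarily small volume.\<close>

lemma negligible_cone_bounded:
  fixes x :: "'a::euclidean_space"
  assumes "hausdorff_measure (DIM('a) - 1) N = 0" "DIM('a) \<ge> 2" "N \<subseteq> cball x R" "c \<ge> 0" "R \<ge> 0"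
  shows "negligible (cone x c N)"
proof -
  define A where "A = unit_ball_vol DIM('a) * (c + 1) * (R + c) ^ DIM('a)"
  have "A \<ge> 0" using assms by (simp add: A_def)
  have "\<exists>T\<in>sets lebesgue. cone x c N \<subseteq> T \<and> emeasure lebesgue T \<le> ennreal e" if "e > 0" for e
  proof -
    \<comment> \<open>The denominator is A + 1 because \<open>A\<close> vanishes when R + c =
      0.\<close>
    have "e / (A + 1) > 0" using that \<open>A \<ge> 0\<close> by simp
    then obtain S d where S: "N \<subseteq> (\<Union>i. S i)"
      "\<And>i x y. x \<in> S i \<Longrightarrow> y \<in> S i \<Longrightarrow> dist x y \<le> d i" "\<And>i. 0 < d i" "\<And>i. d i \<le> 1"
      "(\<Sum>i. ennreal (d i ^ (DIM('a) - 1))) \<le> ennreal (e / (A + 1))"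
      using assms(2) by (elim hausdorff_null_cover_pos[OF assms(1), rotated]) auto
    \<comment> \<open>The covering sets may reach far from \<open>x\<close>, so each is cut down to
      the ball that contains \<open>N\<close>.\<close>
    have "\<exists>T. T \<in> sets lborel \<and> cone x c (S i \<inter> cball x R) \<subseteq> T \<and>
        emeasure lborel T \<le> ennreal (A * d i ^ (DIM('a) - 1))" for i
      using cone_small_cover[of "S i \<inter> cball x R" "d i" x R c] S(2,3,4) assms(4,5) unfolding A_def
      by (metis IntD1 inf_le2)
    then obtain T where T: "\<And>i. T i \<in> sets lborel" "\<And>i. cone x c (S i \<inter> cball x R) \<subseteq> T i"
      "\<And>i. emeasure lborel (T i) \<le> ennreal (A * d i ^ (DIM('a) - 1))" by metis
    have sub: "cone x c N \<subseteq> (\<Union>i. T i)"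
    proof
      fix v assume "v \<in> cone x c N"
      then obtain s y where v: "v = s *\<^sub>R (y - x)" "0 \<le> s" "s \<le> c" "y \<in> N" by (auto simp: cone_def)
      then obtain i where "y \<in> S i \<inter> cball x R" using S(1) assms(3) by blast
      then have "v \<in> cone x c (S i \<inter> cball x R)" using v by (auto simp: cone_def)
      then show "v \<in> (\<Union>i. T i)" using T(2) by blast
    qed
    have "emeasure lborel (\<Union>i. T i) \<le> (\<Sum>i. emeasure lborel (T i))"
      using T(1) by (intro emeasure_subadditive_countably) auto
    also have "\<dots> \<le> (\<Sum>i. ennreal A * ennreal (d i ^ (DIM('a) - 1)))"
      using T(3) S(3) \<open>A \<ge> 0\<close> by (intro suminf_le summableI) (simp add: ennreal_mult less_imp_le)
    also have "\<dots> = ennreal A * (\<Sum>i. ennreal (d i ^ (DIM('a) - 1)))" by simp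
    also have "\<dots> \<le> ennreal A * ennreal (e / (A + 1))" using S(5) by (rule mult_left_mono) simp
    also have "\<dots> = ennreal (A * (e / (A + 1)))" using \<open>A \<ge> 0\<close> that by (simp flip: ennreal_mult)
    also have "\<dots> \<le> ennreal e" using \<open>A \<ge> 0\<close> that by (intro ennreal_leI) (simp add: field_simps)
    finally have "emeasure lborel (\<Union>i. T i) \<le> ennreal e" .
    moreover have "(\<Union>i. T i) \<in> sets lborel" using T(1) by auto
    ultimately show ?thesis using sub by (intro bexI[of _ "\<Union>i. T i"]) auto
  qed
  then show ?thesis
    unfolding negligible_outer_le
    by (metis emeasure_eq_ennreal_measure ennreal_le_iff fmeasurableI infinity_ennreal_def less_imp_le
        ennreal_less_top le_less_trans top.not_eq_extremum)
qed

text \<open>A direction of length below 1 cannot reach \<open>N\<close> before time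
  \<open>r\<close>, so the parameter 1/t is at most 1/r. Cutting \<open>N\<close> by balls of
  integer radius reduces the claim to countably many bounded cones.\<close>

lemma negligible_rays_to_null_set:
  fixes x :: "'a::euclidean_space"
  assumes "hausdorff_measure (DIM('a) - 1) N = 0" "DIM('a) \<ge> 2" "ball x r \<inter> N = {}" "r > 0"
  shows "negligible {z \<in> ball 0 1. \<exists>t>0. x + t *\<^sub>R z \<in> N}"
proof (rule negligible_subset)
  have "hausdorff_measure (DIM('a) - 1) (N \<inter> cball x (real R)) = 0" for R :: nat
    using hausdorff_measure_mono[of "N \<inter> cball x (real R)" N "DIM('a) - 1"] assms(1) by simp
  then show "negligible (\<Union>R::nat. cone x (1 / r) (N \<inter> cball x (real R)))"
    using assms by (intro negligible_countable_Union negligible_cone_bounded) (auto intro: negligible_cone_bounded)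
  show "{z \<in> ball 0 1. \<exists>t>0. x + t *\<^sub>R z \<in> N} \<subseteq> (\<Union>R::nat. cone x (1 / r) (N \<inter> cball x (real R)))"
  proof safe
    fix z t assume z: "z \<in> ball (0::'a) 1" "t > 0" "x + t *\<^sub>R z \<in> N"
    obtain R :: nat where R: "norm (t *\<^sub>R z) \<le> R" using real_arch_simple by blast
    have "x + t *\<^sub>R z \<notin> ball x r" using z assms(3) by blast
    then have "r \<le> t * norm z" using z(2) by (simp add: dist_norm)
    also have "\<dots> \<le> t * 1" using z by (intro mult_left_mono) auto
    finally have "1 / t \<le> 1 / r" using \<open>r > 0\<close> by (simp add: frac_le)
    moreover have "z = (1 / t) *\<^sub>R ((x + t *\<^sub>R z) - x)" using z(2) by simp
    moreover have "x + t *\<^sub>R z \<in> N \<inter> cball x R" using z(3) R by (simp add: dist_norm)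
    ultimately have "z \<in> cone x (1 / r) (N \<inter> cball x R)"
      unfolding cone_def using z(2) by (smt (verit) divide_pos_pos mem_Collect_eq)
    then show "z \<in> (\<Union>R::nat. cone x (1 / r) (N \<inter> cball x (real R)))" by blast
  qed
qed

section \<open>The mollified function along a ray\<close>

text \<open>The Leibniz rule and the fundamental theorem are applied to \<open>integral\<close> over
  a box, while mollified values and distributional derivatives are Bochner integrals; this passes
  between the two.\<close>

lemma integral_compact_support:
  fixes g :: "'a::euclidean_space \<Rightarrow> real"
  assumes "continuous_on UNIV g" "\<And>y. y \<notin> cbox a b \<Longrightarrow> g y = 0"
  shows "integrable lborel g" "integral (cbox a b) g = integral\<^sup>L lborel g"
proof -
  have eq: "(\<lambda>y. indicator (cbox a b) y *\<^sub>R g y) = g"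
    by (rule ext) (metis assms(2) indicator_simps mult_zero_right real_scaleR_def scaleR_one)
  have g: "set_integrable lborel (cbox a b) g"
    unfolding set_integrable_def by (rule borel_integrable_compact) (use assms in \<open>auto intro: continuous_on_subset\<close>)
  then show "integrable lborel g" by (simp only: set_integrable_def eq)
  show "integral (cbox a b) g = integral\<^sup>L lborel g"
    using set_borel_integral_eq_integral(2)[OF g] by (simp only: set_lebesgue_integral_def eq)
qed

lemma mollifier_deriv_axis_sum:
  fixes y z :: "real^'n"
  shows "mollifier_deriv e y z = (\<Sum>j\<in>UNIV. z $ j * mollifier_deriv e y (axis j 1))"
proof -
  have "y \<bullet> z = (\<Sum>j\<in>UNIV. z $ j * (y \<bullet> axis j 1))"
    by (simp add: inner_axis inner_vec_def[of y z] mult_ac)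
  then show ?thesis
    unfolding mollifier_deriv_def by (simp add: sum_distrib_left sum_divide_distrib mult_ac)
qed

text \<open>Cauchy-Schwarz for the Frobenius inner product of \<open>M\<close> with z z^T, whose
  norm is the square of that of \<open>z\<close>.\<close>

lemma quadratic_form_le_norm:
  fixes M :: "real^'n^'n"
  shows "\<bar>\<Sum>i\<in>UNIV. \<Sum>j\<in>UNIV. z $ i * z $ j * M $ i $ j\<bar> \<le> norm M * (norm z)\<^sup>2"
proof -
  define Z :: "real^'n^'n" where "Z = (\<chi> i j. z $ i * z $ j)"
  have "Z \<bullet> Z = (\<Sum>i\<in>UNIV. \<Sum>j\<in>UNIV. (z $ i * z $ i) * (z $ j * z $ j))"
    by (simp add: Z_def inner_vec_def mult_ac)
  also have "\<dots> = (z \<bullet> z)\<^sup>2"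
    by (simp add: inner_vec_def power2_eq_square sum_product)
  finally have "norm Z = (norm z)\<^sup>2"
    by (simp add: norm_eq_sqrt_inner)
  moreover have "(\<Sum>i\<in>UNIV. \<Sum>j\<in>UNIV. z $ i * z $ j * M $ i $ j) = M \<bullet> Z"
    by (simp add: Z_def inner_vec_def mult_ac)
  ultimately show ?thesis using Cauchy_Schwarz_ineq2[of M Z] by simp
qed

text \<open>A quadratic form sees only the symmetric part of its matrix; this is where the full
  distributional gradient gives way to the symmetric one.\<close>

lemma quadratic_form_symmetrize:
  fixes D :: "real^'n^'n"
  shows "(\<Sum>i\<in>UNIV. \<Sum>j\<in>UNIV. z $ i * z $ j * ((1 / 2) *\<^sub>R (D + transpose D)) $ i $ j)
    = (\<Sum>i\<in>UNIV. \<Sum>j\<in>UNIV. z $ i * z $ j * D $ i $ j)"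
proof -
  have "(\<Sum>i\<in>UNIV. \<Sum>j\<in>UNIV. z $ i * z $ j * D $ j $ i) = (\<Sum>i\<in>UNIV. \<Sum>j\<in>UNIV. z $ i * z $ j * D $ i $ j)"
    by (subst sum.swap) (simp add: mult_ac)
  then show ?thesis
    by (simp add: transpose_def distrib_left sum.distrib add_divide_distrib flip: sum_divide_distrib)
qed

lemma norm_sym_grad_mollifier_le:
  fixes E :: "real^'n \<Rightarrow> real^'n^'n"
  assumes f: "f \<in> borel_measurable borel" "AE y in lebesgue. f y = indicator \<Omega> y * norm (E y)"
  shows "ennreal (norm (LINT y:\<Omega>|lebesgue. mollifier e (y - a) *\<^sub>R E y)) \<le> mollify e f a"
proof (cases "integrable lebesgue (\<lambda>y. indicator \<Omega> y *\<^sub>R (mollifier e (y - a) *\<^sub>R E y))")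
  case True
  have "ennreal (norm (LINT y:\<Omega>|lebesgue. mollifier e (y - a) *\<^sub>R E y))
      \<le> (\<integral>\<^sup>+ y. ennreal (norm (indicator \<Omega> y *\<^sub>R (mollifier e (y - a) *\<^sub>R E y))) \<partial>lebesgue)"
    unfolding set_lebesgue_integral_def using True by (rule integral_norm_bound_ennreal)
  also have "\<dots> = (\<integral>\<^sup>+ y. ennreal (mollifier e (y - a)) * ennreal (f y) \<partial>lebesgue)"
  proof (rule nn_integral_cong_AE)
    show "AE y in lebesgue. ennreal (norm (indicator \<Omega> y *\<^sub>R (mollifier e (y - a) *\<^sub>R E y)))
        = ennreal (mollifier e (y - a)) * ennreal (f y)"
      using f(2)
    proof eventually_elim
      case (elim y)
      then show ?case by (auto simp: indicator_def ennreal_mult mollifier_nonneg)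
    qed
  qed
  also have "\<dots> = mollify e f a"
    unfolding mollify_def using f(1) by (intro nn_integral_completion) measurable
  finally show ?thesis .
next
  case False
  \<comment> \<open>A Bochner integral takes the default value 0 on a nonintegrable function, so the
    left side vanishes.\<close>
  then show ?thesis by (simp add: set_lebesgue_integral_def not_integrable_integral_eq)
qed

text \<open>Testing the symmetric gradient with the mollifier centred at \<open>a\<close> and
  contracting with z z^T yields the integral on the left, which will be the derivative of the
  mollified \<open>z \<bullet> v\<close> along the ray. The ball about \<open>a\<close> has to lie
  in \<Omega> for the mollifier to be a test function there.\<close>

lemma integral_mollifier_deriv_le:
  fixes u v :: "real^'n \<Rightarrow> real^'n" and E :: "real^'n \<Rightarrow> real^'n^'n"
  assumes E: "is_sym_grad \<Omega> u E"
    and v: "continuous_on UNIV v" "\<And>y. y \<in> \<Omega> \<Longrightarrow> v y = u y"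
    and f: "f \<in> borel_measurable borel" "AE y in lebesgue. f y = indicator \<Omega> y * norm (E y)"
    and "e > 0" and a: "cball a e \<subseteq> \<Omega>" "cball a e \<subseteq> cbox A B" and z: "norm z \<le> 1"
  shows "ennreal \<bar>integral (cbox A B) (\<lambda>y. (z \<bullet> v y) * mollifier_deriv e (y - a) (- z))\<bar> \<le> mollify e f a"
proof -
  define \<phi> where "\<phi> y = mollifier e (y - a)" for y
  define M where "M = (LINT y:\<Omega>|lebesgue. \<phi> y *\<^sub>R E y)"
  have md_0: "mollifier_deriv e (y - a) h = 0" if "y \<notin> cball a e" for y h
    using that mollifier_deriv_eq_0[OF \<open>e > 0\<close>, of "y - a"] by (simp add: dist_norm norm_minus_commute)
  define g where "g i j y = v y $ i * mollifier_deriv e (y - a) (axis j 1)" for i j y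
  have cont: "continuous_on UNIV (g i j)" for i j
    unfolding g_def by (intro continuous_intros v)
  have g_0: "g i j y = 0" if "y \<notin> cball a e" for i j y
    using md_0[OF that] by (simp add: g_def)
  then have g_0': "g i j y = 0" if "y \<notin> cbox A B" for i j y
    using that a(2) by blast
  note g_int = integral_compact_support[OF cont g_0']
  have D: "dist_grad \<Omega> u \<phi> $ i $ j = - integral\<^sup>L lborel (g i j)" for i j
  proof -
    have "indicator \<Omega> y *\<^sub>R (u y $ i * partial_deriv j \<phi> y) = g i j y" for y
    proof (cases "y \<in> \<Omega>")
      case True
      then show ?thesis by (simp add: v(2) g_def \<phi>_def[abs_def] partial_deriv_mollifier_shift)
    next
      case False
      then have "g i j y = 0" using g_0 a(1) by blast
      then show ?thesis using False by simp
    qed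
    then have "(LINT y:\<Omega>|lebesgue. u y $ i * partial_deriv j \<phi> y) = integral\<^sup>L lebesgue (g i j)"
      by (simp add: set_lebesgue_integral_def)
    also have "\<dots> = integral\<^sup>L lborel (g i j)"
      by (rule integral_completion) (use g_int(1) in auto)
    finally show ?thesis by (simp add: dist_grad_def)
  qed
  \<comment> \<open>The direction is -z because the centre moves with velocity \<open>z\<close>.
    This sign cancels the one in the definition of the distributional derivative.\<close>
  have "(\<lambda>y. (z \<bullet> v y) * mollifier_deriv e (y - a) (- z))
      = (\<lambda>y. - (\<Sum>i\<in>UNIV. \<Sum>j\<in>UNIV. z $ i * z $ j * g i j y))"
  proof
    fix y
    have "mollifier_deriv e (y - a) (- z) = - mollifier_deriv e (y - a) z"
      by (simp add: mollifier_deriv_def)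
    then show "(z \<bullet> v y) * mollifier_deriv e (y - a) (- z)
        = - (\<Sum>i\<in>UNIV. \<Sum>j\<in>UNIV. z $ i * z $ j * g i j y)"
      by (simp add: mollifier_deriv_axis_sum[of e "y - a" z] inner_vec_def[of z] sum_product g_def mult_ac)
  qed
  moreover have "integral (cbox A B) (\<lambda>y. - (\<Sum>i\<in>UNIV. \<Sum>j\<in>UNIV. z $ i * z $ j * g i j y))
      = integral\<^sup>L lborel (\<lambda>y. - (\<Sum>i\<in>UNIV. \<Sum>j\<in>UNIV. z $ i * z $ j * g i j y))"
    by (rule integral_compact_support) (auto simp: g_0' intro!: continuous_intros cont)
  moreover have "\<dots> = (\<Sum>i\<in>UNIV. \<Sum>j\<in>UNIV. z $ i * z $ j * dist_grad \<Omega> u \<phi> $ i $ j)"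
    using g_int(1) by (simp add: D sum_negf)
  moreover have "\<dots> = (\<Sum>i\<in>UNIV. \<Sum>j\<in>UNIV. z $ i * z $ j * M $ i $ j)"
  proof -
    have "\<phi> \<in> test_functions \<Omega>"
      unfolding \<phi>_def[abs_def] by (rule mollifier_shift_test_function[OF \<open>e > 0\<close> a(1)])
    then have "M = dist_sym_grad \<Omega> u \<phi>" using E by (simp add: is_sym_grad_def M_def)
    then show ?thesis unfolding dist_sym_grad_def by (simp only: quadratic_form_symmetrize)
  qed
  ultimately have "\<bar>integral (cbox A B) (\<lambda>y. (z \<bullet> v y) * mollifier_deriv e (y - a) (- z))\<bar>
      \<le> norm M * (norm z)\<^sup>2"
    using quadratic_form_le_norm[of z M] by simp
  also have "\<dots> \<le> norm M * 1"
    using z by (intro mult_left_mono) (auto simp: power_le_one)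
  finally have "ennreal \<bar>integral (cbox A B) (\<lambda>y. (z \<bullet> v y) * mollifier_deriv e (y - a) (- z))\<bar> \<le> ennreal (norm M)"
    by (simp add: ennreal_leI)
  also have "\<dots> \<le> mollify e f a"
    unfolding M_def \<phi>_def by (rule norm_sym_grad_mollifier_le[OF f])
  finally show ?thesis .
qed

text \<open>The fundamental theorem of calculus for the mollified scalar
  \<open>z \<bullet> v\<close> on the segment, with its derivative bounded by
  \<open>integral_mollifier_deriv_le\<close>.\<close>

lemma mollified_increment_le_ray_potential:
  fixes u v :: "real^'n \<Rightarrow> real^'n" and E :: "real^'n \<Rightarrow> real^'n^'n"
  assumes E: "is_sym_grad \<Omega> u E"
    and v: "continuous_on UNIV v" "\<And>y. y \<in> \<Omega> \<Longrightarrow> v y = u y"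
    and f: "f \<in> borel_measurable borel" "AE y in lebesgue. f y = indicator \<Omega> y * norm (E y)"
    and "e > 0" "\<tau> > 0" and seg: "\<And>t. 0 \<le> t \<Longrightarrow> t \<le> \<tau> \<Longrightarrow> cball (x + t *\<^sub>R z) e \<subseteq> \<Omega>"
    and z: "norm z \<le> 1"
  shows "ennreal \<bar>(LINT y|lborel. (z \<bullet> v y) * mollifier e (y - (x + \<tau> *\<^sub>R z)))
      - (LINT y|lborel. (z \<bullet> v y) * mollifier e (y - x))\<bar> \<le> ray_potential \<Omega> e f x z"
proof -
  \<comment> \<open>One box holds the supports of the shifted mollifiers for all times up to \<tau>,
    so the domain of integration does not move.\<close>
  obtain A B where AB: "cball x (\<tau> + e) \<subseteq> cbox A B"
    using bounded_subset_cbox_symmetric[OF bounded_cball] by metis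
  have sub: "cball (x + t *\<^sub>R z) e \<subseteq> cbox A B" if "0 \<le> t" "t \<le> \<tau>" for t
  proof -
    have "norm (t *\<^sub>R z) \<le> \<tau>" using that z mult_mono[of t \<tau> "norm z" 1] by simp
    then have "cball (x + t *\<^sub>R z) e \<subseteq> cball x (\<tau> + e)"
      by (simp add: cball_subset_cball_iff dist_norm)
    then show ?thesis using AB by blast
  qed
  define G where "G t y = (z \<bullet> v y) * mollifier e (y - (x + t *\<^sub>R z))" for t y
  define G' where "G' t y = (z \<bullet> v y) * mollifier_deriv e (y - (x + t *\<^sub>R z)) (- z)" for t y
  define H where "H t = integral (cbox A B) (G t)" for t
  define H' where "H' t = integral (cbox A B) (G' t)" for t
  have G_deriv: "((\<lambda>t. G t y) has_vector_derivative G' t y) (at t within {0..\<tau>})" for t y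
  proof -
    have "((\<lambda>t. y - (x + t *\<^sub>R z)) has_derivative (\<lambda>s. s *\<^sub>R (- z))) (at t within {0..\<tau>})"
      by (auto intro!: derivative_eq_intros)
    from has_derivative_compose[OF this mollifier_has_derivative]
    have "((\<lambda>t. mollifier e (y - (x + t *\<^sub>R z))) has_derivative
        (\<lambda>s. mollifier_deriv e (y - (x + t *\<^sub>R z)) (s *\<^sub>R (- z)))) (at t within {0..\<tau>})" .
    from has_derivative_mult_right[OF this, of "z \<bullet> v y"]
    show ?thesis
      unfolding has_vector_derivative_def G_def G'_def by (simp add: mollifier_deriv_def mult_ac)
  qed
  have contG: "continuous_on UNIV (G t)" for t
    unfolding G_def by (intro continuous_intros v continuous_on_compose2[OF continuous_on_mollifier[of UNIV]]) auto
  have contG': "continuous_on ({0..\<tau>} \<times> cbox A B) (\<lambda>(t, y). G' t y)"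
    unfolding G'_def case_prod_beta
    by (intro continuous_intros continuous_on_compose2[OF v(1)]) auto
  have H_deriv: "(H has_vector_derivative H' t) (at t within {0..\<tau>})" if "t \<in> {0..\<tau>}" for t
    unfolding H_def[abs_def] H'_def
    by (rule leibniz_rule_vector_derivative[OF G_deriv _ contG' that])
      (auto intro!: integrable_continuous continuous_on_subset[OF contG])
  have contH': "continuous_on {0..\<tau>} H'"
    unfolding H'_def[abs_def] by (rule integral_continuous_on_param[OF contG'])
  have "(H' has_integral H \<tau> - H 0) {0..\<tau>}"
    using H_deriv \<open>\<tau> > 0\<close> by (intro fundamental_theorem_of_calculus) auto
  then have "\<bar>H \<tau> - H 0\<bar> \<le> integral {0..\<tau>} (\<lambda>t. \<bar>H' t\<bar>)"
    using integral_norm_bound_integral[of H' "{0..\<tau>}" "\<lambda>t. \<bar>H' t\<bar>"] contH'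
    by (auto simp: has_integral_iff intro!: integrable_continuous_real continuous_intros)
  then have "ennreal \<bar>H \<tau> - H 0\<bar> \<le> ennreal (integral {0..\<tau>} (\<lambda>t. \<bar>H' t\<bar>))"
    by (rule ennreal_leI)
  also have "\<dots> = (\<integral>\<^sup>+ t. ennreal \<bar>H' t\<bar> * indicator {0..\<tau>} t \<partial>lborel)"
    using contH'
    by (intro nn_integral_has_integral_lebesgue'[symmetric])
      (auto simp: has_integral_iff intro!: integrable_continuous_real continuous_intros)
  also have "\<dots> \<le> ray_potential \<Omega> e f x z"
    unfolding ray_potential_def
  proof (rule nn_integral_mono_AE)
    \<comment> \<open>The bound is only almost everywhere since \<open>ray_potential\<close> leaves
      out the time 0.\<close>
    show "AE t in lborel. ennreal \<bar>H' t\<bar> * indicator {0..\<tau>} t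
      \<le> indicator {0<..} t * (indicator \<Omega> (x + t *\<^sub>R z) * mollify e f (x + t *\<^sub>R z))"
      using AE_lborel_singleton[of "0::real"]
    proof eventually_elim
      case (elim t)
      show ?case
      proof (cases "t \<in> {0..\<tau>}")
        case True
        then have "x + t *\<^sub>R z \<in> \<Omega>" using seg[of t] \<open>e > 0\<close> by auto
        moreover have "ennreal \<bar>H' t\<bar> \<le> mollify e f (x + t *\<^sub>R z)"
          unfolding H'_def G'_def
          using True by (intro integral_mollifier_deriv_le[OF E v f \<open>e > 0\<close> seg sub z]) auto
        ultimately show ?thesis using True elim by simp
      qed simp
    qed
  qed
  finally have "ennreal \<bar>H \<tau> - H 0\<bar> \<le> ray_potential \<Omega> e f x z" .
  moreover have H_eq: "H t = (LINT y|lborel. G t y)" if "0 \<le> t" "t \<le> \<tau>" for t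
    unfolding H_def
  proof (rule integral_compact_support(2)[OF contG])
    fix y assume "y \<notin> cbox A B"
    then have "y \<notin> cball (x + t *\<^sub>R z) e" using sub[OF that] by blast
    then show "G t y = 0"
      using mollifier_eq_0[OF \<open>e > 0\<close>, of "y - (x + t *\<^sub>R z)"] by (simp add: G_def dist_norm norm_minus_commute)
  qed
  ultimately show ?thesis
    using H_eq[of \<tau>] H_eq[of 0] \<open>\<tau> > 0\<close> by (simp add: G_def)
qed

section \<open>Passage to the limit\<close>

text \<open>By unit mass the difference is an average of \<open>g y - g a\<close> over a ball of
  radius \<open>e\<close>, where continuity makes it small.\<close>

lemma mollifier_average_tendsto:
  fixes g :: "'a::euclidean_space \<Rightarrow> real"
  assumes g: "continuous_on UNIV g" and "\<eta> > 0"
  shows "\<exists>\<delta>>0. \<forall>e. 0 < e \<longrightarrow> e < \<delta> \<longrightarrow> \<bar>(LINT y|lborel. g y * mollifier e (y - a)) - g a\<bar> \<le> \<eta>"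
proof -
  have "isCont g a" using g by (simp add: continuous_on_eq_continuous_at)
  then obtain \<delta> where \<delta>: "\<delta> > 0" "\<And>y. dist y a < \<delta> \<Longrightarrow> dist (g y) (g a) < \<eta>"
    using \<open>\<eta> > 0\<close> unfolding continuous_at_eps_delta by blast
  have "\<bar>(LINT y|lborel. g y * mollifier e (y - a)) - g a\<bar> \<le> \<eta>" if "0 < e" "e < \<delta>" for e
  proof -
    obtain A B where AB: "cball a e \<subseteq> cbox A B"
      using bounded_subset_cbox_symmetric[OF bounded_cball] by metis
    have moll_0: "mollifier e (y - a) = 0" if "y \<notin> ball a e" for y
      using that mollifier_eq_0[OF \<open>0 < e\<close>, of "y - a"] by (simp add: dist_norm norm_minus_commute)
    have moll_0': "mollifier e (y - a) = 0" if "y \<notin> cbox A B" for y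
      by (rule moll_0) (use that AB in \<open>auto simp: subset_iff\<close>)
    have cont: "continuous_on UNIV (\<lambda>y. mollifier e (y - a))"
      by (intro continuous_on_compose2[OF continuous_on_mollifier[of UNIV]] continuous_intros) auto
    have int1: "integrable lborel (\<lambda>y. g y * mollifier e (y - a))"
      by (rule integral_compact_support(1)[of _ A B]) (auto simp: moll_0' intro!: continuous_intros cont g)
    have int2: "integrable lborel (\<lambda>y. mollifier e (y - a))"
      by (rule integral_compact_support(1)[of _ A B]) (auto simp: moll_0' cont)
    have one: "(LINT y|lborel. mollifier e (y - a)) = 1"
      using nn_integral_eq_integral[OF int2] nn_integral_mollifier_shift(1)[OF \<open>0 < e\<close>, of a]
        Bochner_Integration.integral_nonneg[of lborel "\<lambda>y. mollifier e (y - a)"]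
      by (simp add: mollifier_nonneg)
    have "(LINT y|lborel. g y * mollifier e (y - a)) - g a
        = (LINT y|lborel. (g y - g a) * mollifier e (y - a))"
      using int1 int2 one by (simp add: left_diff_distrib)
    also have "\<bar>\<dots>\<bar> \<le> (LINT y|lborel. \<bar>(g y - g a) * mollifier e (y - a)\<bar>)"
      by (rule integral_abs_bound)
    also have "\<dots> \<le> (LINT y|lborel. \<eta> * mollifier e (y - a))"
    proof (rule integral_mono)
      show "integrable lborel (\<lambda>y. \<bar>(g y - g a) * mollifier e (y - a)\<bar>)"
        using int1 int2 by (intro integrable_abs) (simp add: left_diff_distrib)
      show "\<bar>(g y - g a) * mollifier e (y - a)\<bar> \<le> \<eta> * mollifier e (y - a)" for y
      proof (cases "y \<in> ball a e")
        case True
        then have "\<bar>g y - g a\<bar> \<le> \<eta>"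
          using \<delta>(2)[of y] that by (simp add: dist_real_def dist_commute)
        then show ?thesis using mollifier_nonneg[of e "y - a"]
          by (auto simp: abs_mult intro!: mult_right_mono)
      qed (simp add: moll_0)
    qed (use int2 in simp)
    also have "\<dots> = \<eta>" by (simp add: one)
    finally show ?thesis .
  qed
  then show ?thesis using \<open>\<delta> > 0\<close> by blast
qed

text \<open>A ray that stays in \<Omega> leaves the bounded support, where \<open>u\<close>
  vanishes. Any other ray has a first exit point on the frontier, and stopping slightly earlier
  costs \<eta> by continuity but keeps the whole closed segment inside \<Omega>.\<close>

lemma ray_exit:
  fixes u :: "'a::real_normed_vector \<Rightarrow> 'b::real_normed_vector"
  assumes "open \<Omega>" "x \<in> \<Omega>" "continuous_on (closure \<Omega>) u" "bounded {y \<in> closure \<Omega>. u y \<noteq> 0}"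
    and "z \<noteq> 0" and m: "\<And>t. t > 0 \<Longrightarrow> x + t *\<^sub>R z \<in> frontier \<Omega> \<Longrightarrow> norm (u (x + t *\<^sub>R z)) \<le> m"
    and "m \<ge> 0" "\<eta> > 0"
  shows "\<exists>\<tau>>0. (\<forall>t\<in>{0..\<tau>}. x + t *\<^sub>R z \<in> \<Omega>) \<and> norm (u (x + \<tau> *\<^sub>R z)) \<le> m + \<eta>"
proof (cases "\<forall>t\<ge>0. x + t *\<^sub>R z \<in> \<Omega>")
  case True
  obtain b where b: "b > 0" "\<And>y. y \<in> {y \<in> closure \<Omega>. u y \<noteq> 0} \<Longrightarrow> norm y \<le> b"
    using assms(4) bounded_pos by metis
  \<comment> \<open>At this time the distance from the origin is at least \<tau> times the norm of
    \<open>z\<close> minus the norm of \<open>x\<close>, that is b + 1.\<close>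
  define \<tau> where "\<tau> = (b + norm x + 1) / norm z"
  have "\<tau> > 0" using b(1) \<open>z \<noteq> 0\<close> by (simp add: \<tau>_def add_pos_nonneg)
  have "norm (\<tau> *\<^sub>R z) = b + norm x + 1" using b(1) \<open>z \<noteq> 0\<close> by (simp add: \<tau>_def)
  then have "norm (x + \<tau> *\<^sub>R z) > b" using norm_diff_ineq[of "\<tau> *\<^sub>R z" x] by (simp add: add.commute)
  moreover have "x + \<tau> *\<^sub>R z \<in> closure \<Omega>" using True \<open>\<tau> > 0\<close> by (meson closure_subset less_imp_le subsetD)
  ultimately have "u (x + \<tau> *\<^sub>R z) = 0" using b(2)[of "x + \<tau> *\<^sub>R z"] by (metis (mono_tags, lifting) mem_Collect_eq not_le)
  then show ?thesis using True \<open>\<tau> > 0\<close> \<open>m \<ge> 0\<close> \<open>\<eta> > 0\<close> by (intro exI[of _ \<tau>]) auto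
next
  case False
  define S where "S = {t. 0 \<le> t \<and> x + t *\<^sub>R z \<notin> \<Omega>}"
  have "S = {0..} \<inter> (\<lambda>t. x + t *\<^sub>R z) -` (- \<Omega>)" by (auto simp: S_def)
  moreover have "closed \<dots>"
    using assms(1) by (intro closed_Int closed_vimage continuous_intros) auto
  ultimately have "closed S" by simp
  have "S \<noteq> {}" "bdd_below S" using False by (auto simp: S_def)
  define T where "T = Inf S"
  have "T \<in> S" unfolding T_def using \<open>closed S\<close> \<open>S \<noteq> {}\<close> \<open>bdd_below S\<close> by (simp add: closed_contains_Inf)
  then have "T > 0" "x + T *\<^sub>R z \<notin> \<Omega>" using \<open>x \<in> \<Omega>\<close> by (auto simp: S_def less_le)
  have inside: "x + t *\<^sub>R z \<in> \<Omega>" if "0 \<le> t" "t < T" for t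
    using that cInf_lower[OF _ \<open>bdd_below S\<close>, of t] by (force simp: S_def T_def)
  have "((\<lambda>t. x + t *\<^sub>R z) \<longlongrightarrow> x + T *\<^sub>R z) (at_left T)"
    by (intro tendsto_intros)
  then have T_closure: "x + T *\<^sub>R z \<in> closure \<Omega>"
    by (rule Lim_in_closed_set[rotated -1])
      (use \<open>T > 0\<close> in \<open>auto intro!: eventually_at_leftI[of 0] closure_subset[THEN subsetD] inside\<close>)
  then have "x + T *\<^sub>R z \<in> frontier \<Omega>"
    using \<open>x + T *\<^sub>R z \<notin> \<Omega>\<close> assms(1) by (simp add: frontier_def interior_open)
  then have uT: "norm (u (x + T *\<^sub>R z)) \<le> m" using m \<open>T > 0\<close> by blast
  have "continuous_on {0..T} (\<lambda>t. u (x + t *\<^sub>R z))"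
  proof (rule continuous_on_compose2[OF assms(3)])
    show "(\<lambda>t. x + t *\<^sub>R z) ` {0..T} \<subseteq> closure \<Omega>"
    proof safe
      fix t assume "t \<in> {0..T}"
      then show "x + t *\<^sub>R z \<in> closure \<Omega>"
        using inside[of t] T_closure by (cases "t = T") (auto intro: closure_subset[THEN subsetD])
    qed
  qed (intro continuous_intros)
  then obtain \<delta> where \<delta>: "\<delta> > 0"
    "\<And>t. t \<in> {0..T} \<Longrightarrow> dist t T < \<delta> \<Longrightarrow> dist (u (x + t *\<^sub>R z)) (u (x + T *\<^sub>R z)) < \<eta>"
    using \<open>T > 0\<close> \<open>\<eta> > 0\<close> unfolding continuous_on_iff by (metis atLeastAtMost_iff less_imp_le order_refl)
  \<comment> \<open>T/2 keeps \<tau> positive, and T - \<delta>/2 keeps it within \<delta> of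
    \<open>T\<close>.\<close>
  define \<tau> where "\<tau> = max (T / 2) (T - \<delta> / 2)"
  have \<tau>: "\<tau> > 0" "\<tau> < T" "dist \<tau> T < \<delta>"
    using \<open>T > 0\<close> \<open>\<delta> > 0\<close> by (auto simp: \<tau>_def dist_real_def)
  then have "dist (u (x + \<tau> *\<^sub>R z)) (u (x + T *\<^sub>R z)) < \<eta>" by (intro \<delta>(2)) auto
  then have "norm (u (x + \<tau> *\<^sub>R z)) \<le> m + \<eta>"
    using uT norm_triangle_sub[of "u (x + \<tau> *\<^sub>R z)" "u (x + T *\<^sub>R z)"] by (simp add: dist_norm)
  then show ?thesis using \<tau> inside by (intro exI[of _ \<tau>]) auto
qed

text \<open>One \<eta> pays for stopping before the exit, the other two for replacing
  \<open>z \<bullet> u\<close> by its mollification at the two ends of the segment.\<close>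

lemma directional_bound:
  fixes u :: "real^'n \<Rightarrow> real^'n" and E :: "real^'n \<Rightarrow> real^'n^'n"
  assumes "open \<Omega>" "x \<in> \<Omega>" "continuous_on (closure \<Omega>) u" "bounded {y \<in> closure \<Omega>. u y \<noteq> 0}"
    and E: "is_sym_grad \<Omega> u E"
    and f: "f \<in> borel_measurable borel" "AE y in lebesgue. f y = indicator \<Omega> y * norm (E y)"
    and z: "norm z \<le> 1" and m: "\<And>t. t > 0 \<Longrightarrow> x + t *\<^sub>R z \<in> frontier \<Omega> \<Longrightarrow> norm (u (x + t *\<^sub>R z)) \<le> m"
    and "m \<ge> 0" "\<eta> > 0"
  shows "ennreal \<bar>z \<bullet> u x\<bar> \<le> ennreal (m + 3 * \<eta>)
    + liminf (\<lambda>k. ray_potential \<Omega> (inverse (real (Suc k))) f x z)"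
proof (cases "z = 0")
  case False
  then obtain \<tau> where \<tau>: "\<tau> > 0" "\<And>t. t \<in> {0..\<tau>} \<Longrightarrow> x + t *\<^sub>R z \<in> \<Omega>" "norm (u (x + \<tau> *\<^sub>R z)) \<le> m + \<eta>"
    using ray_exit[OF assms(1-4) False m \<open>m \<ge> 0\<close> \<open>\<eta> > 0\<close>] by metis
  obtain v where v: "continuous_on UNIV v" "\<And>y. y \<in> closure \<Omega> \<Longrightarrow> v y = u y"
    using Tietze_unbounded[OF assms(3), of UNIV] by auto
  have vu: "v y = u y" if "y \<in> \<Omega>" for y using v(2) that closure_subset by blast
  have "compact ((\<lambda>t. x + t *\<^sub>R z) ` {0..\<tau>})"
    by (intro compact_continuous_image continuous_intros) auto
  then obtain d where d: "d > 0" "(\<Union>y\<in>(\<lambda>t. x + t *\<^sub>R z) ` {0..\<tau>}. cball y d) \<subseteq> \<Omega>"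
    using compact_subset_open_imp_cball_epsilon_subset[OF _ assms(1)] \<tau>(2) by (metis image_subsetI)
  have g: "continuous_on UNIV (\<lambda>y. z \<bullet> v y)" by (intro continuous_intros v)
  define U where "U e a = (LINT y|lborel. (z \<bullet> v y) * mollifier e (y - a))" for e a
  obtain \<delta> where \<delta>: "\<delta> > 0" "\<And>e. 0 < e \<Longrightarrow> e < \<delta> \<Longrightarrow> \<bar>U e x - z \<bullet> v x\<bar> \<le> \<eta>"
    using mollifier_average_tendsto[OF g \<open>\<eta> > 0\<close>, of x] unfolding U_def by auto
  obtain \<delta>' where \<delta>': "\<delta>' > 0"
    "\<And>e. 0 < e \<Longrightarrow> e < \<delta>' \<Longrightarrow> \<bar>U e (x + \<tau> *\<^sub>R z) - z \<bullet> v (x + \<tau> *\<^sub>R z)\<bar> \<le> \<eta>"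
    using mollifier_average_tendsto[OF g \<open>\<eta> > 0\<close>, of "x + \<tau> *\<^sub>R z"] unfolding U_def by auto
  \<comment> \<open>Truncated subtraction leaves a left side constant in \<open>e\<close>, which
    passes to the limes inferior; the subtracted term is moved back afterwards.\<close>
  have step: "ennreal \<bar>z \<bullet> u x\<bar> - ennreal (m + 3 * \<eta>) \<le> ray_potential \<Omega> e f x z"
    if e: "e > 0" "e < d" "e < \<delta>" "e < \<delta>'" for e
  proof -
    have "cball (x + t *\<^sub>R z) e \<subseteq> \<Omega>" if "0 \<le> t" "t \<le> \<tau>" for t
    proof -
      have "cball (x + t *\<^sub>R z) d \<subseteq> \<Omega>" using d(2) that by (simp add: UN_subset_iff)
      moreover have "cball (x + t *\<^sub>R z) e \<subseteq> cball (x + t *\<^sub>R z) d" using e by auto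
      ultimately show ?thesis by blast
    qed
    then have R: "ennreal \<bar>U e (x + \<tau> *\<^sub>R z) - U e x\<bar> \<le> ray_potential \<Omega> e f x z"
      unfolding U_def by (intro mollified_increment_le_ray_potential[OF E v(1) vu f \<open>e > 0\<close> \<open>\<tau> > 0\<close> _ z])
    have "\<bar>z \<bullet> u (x + \<tau> *\<^sub>R z)\<bar> \<le> 1 * (m + \<eta>)"
      using Cauchy_Schwarz_ineq2[of z "u (x + \<tau> *\<^sub>R z)"] z \<tau>(3)
        mult_mono[of "norm z" 1 "norm (u (x + \<tau> *\<^sub>R z))" "m + \<eta>"] by simp
    then have "\<bar>z \<bullet> u x\<bar> \<le> (m + 3 * \<eta>) + \<bar>U e (x + \<tau> *\<^sub>R z) - U e x\<bar>"
      using \<delta>(2)[of e] \<delta>'(2)[of e] e vu[OF \<open>x \<in> \<Omega>\<close>] vu[of "x + \<tau> *\<^sub>R z"] \<tau>(1) \<tau>(2)[of \<tau>] by auto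
    then have "ennreal \<bar>z \<bullet> u x\<bar> \<le> ennreal (m + 3 * \<eta>) + ennreal \<bar>U e (x + \<tau> *\<^sub>R z) - U e x\<bar>"
      using \<open>m \<ge> 0\<close> \<open>\<eta> > 0\<close> by (simp add: ennreal_leI flip: ennreal_plus)
    also have "\<dots> \<le> ennreal (m + 3 * \<eta>) + ray_potential \<Omega> e f x z"
      using R by (rule add_left_mono)
    finally show ?thesis by (simp add: ennreal_minus_le_iff)
  qed
  have "eventually (\<lambda>k. inverse (real (Suc k)) < min d (min \<delta> \<delta>')) sequentially"
    using LIMSEQ_inverse_real_of_nat d(1) \<delta>(1) \<delta>'(1) by (intro order_tendstoD(2)) auto
  then have "eventually (\<lambda>k. ennreal \<bar>z \<bullet> u x\<bar> - ennreal (m + 3 * \<eta>)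
      \<le> ray_potential \<Omega> (inverse (real (Suc k))) f x z) sequentially"
    by eventually_elim (rule step, auto)
  then have "ennreal \<bar>z \<bullet> u x\<bar> - ennreal (m + 3 * \<eta>)
      \<le> liminf (\<lambda>k. ray_potential \<Omega> (inverse (real (Suc k))) f x z)"
    by (rule Liminf_bounded)
  then show ?thesis by (simp add: ennreal_minus_le_iff)
qed simp

section \<open>From directional bounds to a bound at each point\<close>

lemma nn_integral_abs_inner_ge:
  fixes w :: "'a::euclidean_space"
  shows "ennreal (norm w * (unit_ball_vol DIM('a) / 4 ^ (DIM('a) + 1)))
    \<le> (\<integral>\<^sup>+ z. indicator (ball 0 1) z * ennreal \<bar>z \<bullet> w\<bar> \<partial>lborel)"
proof (cases "w = 0")
  case False
  \<comment> \<open>The ball of radius 1/4 about \<open>c\<close> lies in the unit ball, and on it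
    \<open>\<bar>z \<bullet> w\<bar>\<close> is at least a quarter of the norm of \<open>w\<close>.
    This last quarter accounts for the exponent n + 1.\<close>
  define c where "c = (1 / (2 * norm w)) *\<^sub>R w"
  have "norm c = 1 / 2" "c \<bullet> w = norm w / 2"
    using False by (simp_all add: c_def dot_square_norm power2_eq_square)
  have "ennreal (norm w * (unit_ball_vol DIM('a) / 4 ^ (DIM('a) + 1)))
      = ennreal (norm w / 4) * emeasure lborel (ball c (1 / 4))"
    by (simp add: emeasure_ball power_divide mult_ac flip: ennreal_mult)
  also have "\<dots> = (\<integral>\<^sup>+ z. ennreal (norm w / 4) * indicator (ball c (1 / 4)) z \<partial>lborel)"
    by (simp add: nn_integral_cmult_indicator)
  also have "\<dots> \<le> (\<integral>\<^sup>+ z. indicator (ball 0 1) z * ennreal \<bar>z \<bullet> w\<bar> \<partial>lborel)"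
  proof (rule nn_integral_mono)
    fix z
    show "ennreal (norm w / 4) * indicator (ball c (1 / 4)) z \<le> indicator (ball 0 1) z * ennreal \<bar>z \<bullet> w\<bar>"
    proof (cases "z \<in> ball c (1 / 4)")
      case True
      then have zc: "norm (z - c) < 1 / 4" by (simp add: dist_norm norm_minus_commute)
      then have "norm z < 1" using norm_triangle_sub[of z c] \<open>norm c = 1 / 2\<close> by linarith
      have "\<bar>(z - c) \<bullet> w\<bar> \<le> 1 / 4 * norm w"
        using Cauchy_Schwarz_ineq2[of "z - c" w] zc
        by (meson less_imp_le mult_right_mono norm_ge_zero order_trans)
      then have "norm w / 4 \<le> \<bar>z \<bullet> w\<bar>"
        using \<open>c \<bullet> w = norm w / 2\<close> unfolding inner_diff_left by linarith
      then show ?thesis using True \<open>norm z < 1\<close> by (simp add: ennreal_leI)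
    qed simp
  qed
  finally show ?thesis .
qed simp

text \<open>The extension by zero is the limit of its restrictions to a compact exhaustion, hence
  Lebesgue measurable. A Borel function equal almost everywhere to its norm makes the iterated
  integrals in \<open>ray_potential\<close> measurable; an absolute value makes it nonnegative
  everywhere.\<close>

lemma L1_loc_borel_representative:
  fixes E :: "'a::euclidean_space \<Rightarrow> 'b::euclidean_space"
  assumes "open \<Omega>" "E \<in> L1_loc \<Omega>"
  obtains f where "f \<in> borel_measurable borel" "\<And>y. f y \<ge> 0" "AE y in lebesgue. f y = indicator \<Omega> y * norm (E y)"
proof -
  obtain C where C: "\<And>n. compact (C n)" "\<And>n. C n \<subseteq> \<Omega>" "\<And>n. C n \<subseteq> interior (C (Suc n))" "(\<Union>n. C n) = \<Omega>"
    using open_Union_compact_subsets[OF assms(1)] by metis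
  have mono: "C n \<subseteq> C (n + k)" for n k
    by (induction k) (use C(3) interior_subset in \<open>force+\<close>)
  have "(\<lambda>y. indicator \<Omega> y *\<^sub>R E y) \<in> borel_measurable lebesgue"
  proof (rule borel_measurable_LIMSEQ_metric)
    show "(\<lambda>y. indicator (C n) y *\<^sub>R E y) \<in> borel_measurable lebesgue" for n
      using assms(2) C(1,2)[of n] by (auto simp: L1_loc_def set_integrable_def)
    show "(\<lambda>n. indicator (C n) y *\<^sub>R E y) \<longlonglongrightarrow> indicator \<Omega> y *\<^sub>R E y" for y
    proof (cases "y \<in> \<Omega>")
      case True
      then obtain n where "y \<in> C n" using C(4) by blast
      then have "y \<in> C k" if "k \<ge> n" for k using mono[of n "k - n"] that by auto
      then have "eventually (\<lambda>k. indicator (C k) y *\<^sub>R E y = indicator \<Omega> y *\<^sub>R E y) sequentially"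
        using True by (intro eventually_sequentiallyI[of n]) auto
      then show ?thesis by (rule tendsto_eventually)
    next
      case False
      then have "y \<notin> C n" for n using C(2) by blast
      then show ?thesis using False by simp
    qed
  qed
  then have "(\<lambda>y. norm (indicator \<Omega> y *\<^sub>R E y)) \<in> borel_measurable lebesgue" by measurable
  then obtain f' where f': "f' \<in> borel_measurable lborel" "AE y in lborel. norm (indicator \<Omega> y *\<^sub>R E y) = f' y"
    using completion_ex_borel_measurable_real by blast
  show thesis
  proof
    show "(\<lambda>y. \<bar>f' y\<bar>) \<in> borel_measurable borel" using f'(1) by simp
    show "AE y in lebesgue. \<bar>f' y\<bar> = indicator \<Omega> y * norm (E y)"
    proof (rule AE_completion)
      show "AE y in lborel. \<bar>f' y\<bar> = indicator \<Omega> y * norm (E y)"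
        using f'(2)
      proof eventually_elim
        case (elim y)
        then show ?case by (simp flip: elim)
      qed
    qed
  qed auto
qed

text \<open>Integrate \<open>directional_bound\<close> over the unit ball of directions. The left
  side is bounded below by \<open>nn_integral_abs_inner_ge\<close>; on the right, Fatou's lemma and
  the uniform bound on averaged ray potentials apply.\<close>

lemma sup_bound_at_point:
  fixes u :: "real^'n \<Rightarrow> real^'n" and E :: "real^'n \<Rightarrow> real^'n^'n"
  assumes "CARD('n) \<ge> 2" "p > real CARD('n)" "open \<Omega>" "x \<in> \<Omega>"
    and u: "continuous_on (closure \<Omega>) u" "bounded {y \<in> closure \<Omega>. u y \<noteq> 0}"
    and E: "is_sym_grad \<Omega> u E"
    and f: "f \<in> borel_measurable borel" "\<And>y. f y \<ge> 0"
      "AE y in lebesgue. f y = indicator \<Omega> y * norm (E y)"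
    and m: "hausdorff_measure (CARD('n) - 1) {y \<in> frontier \<Omega>. norm (u y) > m} = 0" "m \<ge> 0"
    and F: "(\<integral>\<^sup>+ y. ennreal (f y powr p) \<partial>lborel) \<le> ennreal (F powr p)" "F > 0"
    and L: "emeasure lebesgue \<Omega> \<le> ennreal L" "L \<ge> 0" and "\<eta> > 0"
  shows "norm (u x) * (unit_ball_vol CARD('n) / 4 ^ (CARD('n) + 1))
    \<le> (m + 3 * \<eta>) * unit_ball_vol CARD('n) + F * potential_const CARD('n) p L"
proof -
  let ?B = "ball (0 :: real^'n) 1" and ?V = "unit_ball_vol (real CARD('n))"
  let ?R = "\<lambda>k. ray_potential \<Omega> (inverse (real (Suc k))) f x"
  define N where "N = {y \<in> frontier \<Omega>. norm (u y) > m}"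
  have [measurable]: "\<Omega> \<in> sets borel" "f \<in> borel_measurable borel" "?B \<in> sets borel"
    using \<open>open \<Omega>\<close> f(1) by auto
  obtain r where r: "r > 0" "ball x r \<subseteq> \<Omega>"
    using \<open>open \<Omega>\<close> \<open>x \<in> \<Omega>\<close> openE by blast
  then have "ball x r \<inter> N = {}"
    using \<open>open \<Omega>\<close> by (auto simp: N_def frontier_def interior_open)
  \<comment> \<open>Frontier points where the norm of \<open>u\<close> exceeds \<open>m\<close> are
    met only along a null set of directions; they stay away from \<open>x\<close>, which is
    interior.\<close>
  then have "negligible {z \<in> ?B. \<exists>t>0. x + t *\<^sub>R z \<in> N}"
    using negligible_rays_to_null_set[of N x r] m(1) assms(1) r(1) by (simp add: N_def)
  then have "AE z in lebesgue. z \<notin> {z \<in> ?B. \<exists>t>0. x + t *\<^sub>R z \<in> N}"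
    by (intro AE_not_in) (simp only: negligible_iff_null_sets)
  then have good: "AE z in lborel. z \<notin> {z \<in> ?B. \<exists>t>0. x + t *\<^sub>R z \<in> N}"
    by (simp only: AE_completion_iff)
  \<comment> \<open>The indicator of the ball is put inside the limes inferior, in the form required
    by Fatou's lemma.\<close>
  have "AE z in lborel. indicator ?B z * ennreal \<bar>z \<bullet> u x\<bar>
      \<le> ennreal (m + 3 * \<eta>) * indicator ?B z + liminf (\<lambda>k. indicator ?B z * ?R k z)"
    using good
  proof eventually_elim
    case (elim z)
    show ?case
    proof (cases "z \<in> ?B")
      case True
      then have "ennreal \<bar>z \<bullet> u x\<bar> \<le> ennreal (m + 3 * \<eta>) + liminf (\<lambda>k. ?R k z)"
        using elim \<open>m \<ge> 0\<close> \<open>\<eta> > 0\<close>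
        by (intro directional_bound[OF \<open>open \<Omega>\<close> \<open>x \<in> \<Omega>\<close> u E f(1,3)]) (force simp: N_def)+
      then show ?thesis using True by simp
    qed simp
  qed
  then have "(\<integral>\<^sup>+ z. indicator ?B z * ennreal \<bar>z \<bullet> u x\<bar> \<partial>lborel)
      \<le> (\<integral>\<^sup>+ z. ennreal (m + 3 * \<eta>) * indicator ?B z + liminf (\<lambda>k. indicator ?B z * ?R k z) \<partial>lborel)"
    by (rule nn_integral_mono_AE)
  also have "\<dots> = ennreal (m + 3 * \<eta>) * emeasure lborel ?B
      + (\<integral>\<^sup>+ z. liminf (\<lambda>k. indicator ?B z * ?R k z) \<partial>lborel)"
    by (subst nn_integral_add) (auto simp: nn_integral_cmult_indicator)
  also have "\<dots> \<le> ennreal (m + 3 * \<eta>) * ennreal ?V + ennreal (F * potential_const CARD('n) p L)"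
  proof (rule add_mono)
    show "ennreal (m + 3 * \<eta>) * emeasure lborel ?B \<le> ennreal (m + 3 * \<eta>) * ennreal ?V"
      by (simp add: emeasure_ball)
    have "(\<integral>\<^sup>+ z. liminf (\<lambda>k. indicator ?B z * ?R k z) \<partial>lborel)
        \<le> liminf (\<lambda>k. \<integral>\<^sup>+ z. indicator ?B z * ?R k z \<partial>lborel)"
      by (rule nn_integral_liminf) measurable
    also have "\<dots> \<le> limsup (\<lambda>k. \<integral>\<^sup>+ z. indicator ?B z * ?R k z \<partial>lborel)"
      by (rule Liminf_le_Limsup) simp
    also have "\<dots> \<le> ennreal (F * potential_const CARD('n) p L)"
    proof (rule Limsup_bounded, rule always_eventually, rule allI)
      fix k
      show "(\<integral>\<^sup>+ z. indicator ?B z * ?R k z \<partial>lborel) \<le> ennreal (F * potential_const CARD('n) p L)"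
        using nn_integral_ray_potential[OF f(1) \<open>\<Omega> \<in> sets borel\<close> f(2) _ _ _ F(2) L(2) F(1),
            of "inverse (real (Suc k))" x] L(1) assms(1,2) \<open>\<Omega> \<in> sets borel\<close> by simp
    qed
    finally show "(\<integral>\<^sup>+ z. liminf (\<lambda>k. indicator ?B z * ?R k z) \<partial>lborel)
      \<le> ennreal (F * potential_const CARD('n) p L)" .
  qed
  finally have "ennreal (norm (u x) * (?V / 4 ^ (CARD('n) + 1)))
      \<le> ennreal (m + 3 * \<eta>) * ennreal ?V + ennreal (F * potential_const CARD('n) p L)"
    using nn_integral_abs_inner_ge[of "u x"] by simp
  moreover have "potential_const CARD('n) p L \<ge> 0"
    using assms(1,2) L(2) by (auto simp: potential_const_def intro!: add_nonneg_nonneg divide_nonneg_nonneg)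
  ultimately show ?thesis
    using \<open>m \<ge> 0\<close> \<open>\<eta> > 0\<close> F(2) by (simp add: ennreal_le_iff flip: ennreal_mult ennreal_plus)
qed

section \<open>Choice of the constant and passage to essential suprema\<close>

theorem theorem4p4:
  assumes "CARD('n::finite) \<ge> 2"
  shows "\<exists>C :: real \<Rightarrow> ennreal \<Rightarrow> ennreal \<Rightarrow> real.
    \<forall>(p::real) (\<Omega> :: (real^'n) set).
      p > real CARD('n) \<longrightarrow> open \<Omega> \<longrightarrow> emeasure lebesgue \<Omega> < \<infinity> \<longrightarrow>
      hausdorff_measure (CARD('n) - 1) (frontier \<Omega>) < \<infinity> \<longrightarrow>
      (\<forall>u \<in> E1p p \<Omega> \<inter> Cb (closure \<Omega>). \<forall>E. is_sym_grad \<Omega> u E \<longrightarrow>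
        Linf_norm \<Omega> u \<le>
          ennreal (C p (emeasure lebesgue \<Omega>) (hausdorff_measure (CARD('n) - 1) (frontier \<Omega>))) *
          (Lp_norm p \<Omega> E + Linf_norm_hausdorff (CARD('n) - 1) (frontier \<Omega>) u))"
proof -
  let ?V = "unit_ball_vol (real CARD('n))"
  define c where "c = ?V / 4 ^ (CARD('n) + 1)"
  have "c > 0" by (simp add: c_def)
  define K where "K p L = potential_const CARD('n) p (enn2real L)" for p L
  show ?thesis
  \<comment> \<open>The pointwise bound will be
    \<open>norm (u x) * c \<le> M0 * ?V + F0 * k\<close>; the constant results from bounding both
    coefficients by \<open>?V + k\<close> and dividing by \<open>c\<close>.\<close>
  proof (intro exI[of _ "\<lambda>p L H. (?V + K p L) / c"] allI impI ballI)
    fix p :: real and \<Omega> :: "(real^'n) set" and u :: "real^'n \<Rightarrow> real^'n" and E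
    assume p: "p > real CARD('n)" and \<Omega>: "open \<Omega>" "emeasure lebesgue \<Omega> < \<infinity>"
      and "u \<in> E1p p \<Omega> \<inter> Cb (closure \<Omega>)" and E: "is_sym_grad \<Omega> u E"
    then have u: "continuous_on (closure \<Omega>) u" "bounded {y \<in> closure \<Omega>. u y \<noteq> 0}"
      by (auto simp: Cb_def)
    define L where "L = enn2real (emeasure lebesgue \<Omega>)"
    have L: "emeasure lebesgue \<Omega> \<le> ennreal L" "L \<ge> 0" using \<Omega>(2) by (auto simp: L_def)
    define k where "k = K p (emeasure lebesgue \<Omega>)"
    have k_eq: "k = potential_const CARD('n) p L" by (simp add: k_def K_def L_def)
    have "k \<ge> 0"
      using assms p L(2)
      by (auto simp: k_eq potential_const_def intro!: add_nonneg_nonneg divide_nonneg_nonneg)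
    have "?V > 0" by simp
    \<comment> \<open>Strict positivity matters when the norms on the right are infinite, because 0
      times infinity is 0 in \<open>ennreal\<close>.\<close>
    have C_pos: "(?V + k) / c > 0" using \<open>c > 0\<close> \<open>k \<ge> 0\<close> \<open>?V > 0\<close> by (intro divide_pos_pos add_pos_nonneg)
    let ?M = "Linf_norm_hausdorff (CARD('n) - 1) (frontier \<Omega>) u"
    show "Linf_norm \<Omega> u \<le> ennreal ((?V + K p (emeasure lebesgue \<Omega>)) / c) * (Lp_norm p \<Omega> E + ?M)"
    proof (cases "Lp_norm p \<Omega> E = \<infinity> \<or> ?M = \<infinity>")
      case True
      then have "ennreal ((?V + k) / c) * (Lp_norm p \<Omega> E + ?M) = \<infinity>"
        using C_pos by (auto simp: ennreal_mult_eq_top_iff ennreal_eq_0_iff)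
      then show ?thesis by (simp add: k_def)
    next
      case False
      define M0 where "M0 = enn2real ?M"
      have M0: "?M = ennreal M0" "M0 \<ge> 0" using False by (auto simp: M0_def less_top)
      have "E \<in> L1_loc \<Omega>" using E by (simp add: is_sym_grad_def)
      then obtain f where f: "f \<in> borel_measurable borel" "\<And>y. f y \<ge> 0"
        "AE y in lebesgue. f y = indicator \<Omega> y * norm (E y)"
        by (rule L1_loc_borel_representative[OF \<Omega>(1)]) blast
      define I where "I = (\<integral>\<^sup>+ y. ennreal (f y powr p) \<partial>lborel)"
      have "(\<integral>\<^sup>+ y. ennreal (norm (E y) powr p) \<partial>lebesgue_on \<Omega>)
          = (\<integral>\<^sup>+ y. ennreal (norm (E y) powr p) * indicator \<Omega> y \<partial>lebesgue)"
        using \<Omega>(1) by (intro nn_integral_restrict_space) auto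
      also have "\<dots> = (\<integral>\<^sup>+ y. ennreal (f y powr p) \<partial>lebesgue)"
      proof (rule nn_integral_cong_AE)
        show "AE y in lebesgue. ennreal (norm (E y) powr p) * indicator \<Omega> y = ennreal (f y powr p)"
          using f(3) by eventually_elim (auto simp: indicator_def)
      qed
      also have "\<dots> = I"
        unfolding I_def using f(1) by (intro nn_integral_completion) measurable
      finally have I: "(\<integral>\<^sup>+ y. ennreal (norm (E y) powr p) \<partial>lebesgue_on \<Omega>) = I" .
      define F0 where "F0 = enn2real I powr (1 / p)"
      have "I \<noteq> \<infinity>" and F0: "Lp_norm p \<Omega> E = ennreal F0" "F0 \<ge> 0"
        using False by (auto simp: Lp_norm_def I F0_def Let_def split: if_splits)
      have "F0 powr p = enn2real I" using p by (simp add: F0_def powr_powr)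
      have bound: "norm (u x) * c \<le> M0 * ?V + F0 * k" if "x \<in> \<Omega>" for x
      \<comment> \<open>A small loss is allowed because \<open>M0\<close> is an infimum, approached
        by levels with null superlevel sets, and because \<open>sup_bound_at_point\<close> asks for
        a positive \<open>F\<close> while \<open>F0\<close> may be 0.\<close>
      proof (rule field_le_epsilon)
        fix \<epsilon> :: real assume "\<epsilon> > 0"
        \<comment> \<open>The total error is \<open>\<delta> * (2 * ?V + k)\<close>: weighted by
          \<open>?V\<close>, one \<delta> from the level \<open>w\<close> and one from three times
          \<delta>/3; weighted by \<open>k\<close>, one from \<open>F0 + \<delta>\<close>.\<close>
        define \<delta> where "\<delta> = \<epsilon> / (2 * ?V + k)"
        have "2 * ?V + k > 0" using \<open>k \<ge> 0\<close> \<open>?V > 0\<close> by linarith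
        then have "\<delta> > 0" using \<open>\<epsilon> > 0\<close> by (simp add: \<delta>_def)
        have "?M < ennreal (M0 + \<delta>)" using M0 \<open>\<delta> > 0\<close> by (simp add: ennreal_less_iff)
        then obtain w where w: "w < ennreal (M0 + \<delta>)"
          "hausdorff_measure (CARD('n) - 1) {y \<in> frontier \<Omega>. ennreal (norm (u y)) > w} = 0"
          unfolding Linf_norm_hausdorff_def Inf_less_iff by blast
        have w_eq: "w = ennreal (enn2real w)" using w(1) by (metis ennreal_enn2real ennreal_less_top less_trans)
        then have "enn2real w < M0 + \<delta>" using w(1) M0(2) \<open>\<delta> > 0\<close> by (metis ennreal_less_iff enn2real_nonneg)
        have null: "hausdorff_measure (CARD('n) - 1) {y \<in> frontier \<Omega>. norm (u y) > enn2real w} = 0"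
          using w(2) by (subst (asm) w_eq) (simp add: ennreal_less_iff)
        have "I = ennreal (enn2real I)" using \<open>I \<noteq> \<infinity>\<close> by (simp add: less_top)
        also have "\<dots> \<le> ennreal ((F0 + \<delta>) powr p)"
          unfolding \<open>F0 powr p = enn2real I\<close>[symmetric]
          using F0(2) \<open>\<delta> > 0\<close> p by (intro ennreal_leI powr_mono2) auto
        finally have "norm (u x) * c \<le> (enn2real w + 3 * (\<delta> / 3)) * ?V + (F0 + \<delta>) * k"
          unfolding c_def k_eq using F0(2) \<open>\<delta> > 0\<close>
          by (intro sup_bound_at_point[OF assms p \<Omega>(1) that u E f null _ _ _ L]) (auto simp: I_def)
        also have "\<dots> \<le> (M0 + 2 * \<delta>) * ?V + (F0 + \<delta>) * k"
          using \<open>enn2real w < M0 + \<delta>\<close> \<open>?V > 0\<close> by (intro add_right_mono mult_right_mono) auto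
        also have "\<dots> = M0 * ?V + F0 * k + \<delta> * (2 * ?V + k)" by (simp add: algebra_simps)
        also have "\<delta> * (2 * ?V + k) = \<epsilon>" using \<open>2 * ?V + k > 0\<close> by (simp add: \<delta>_def)
        finally show "norm (u x) * c \<le> M0 * ?V + F0 * k + \<epsilon>" .
      qed
      have "norm (u x) \<le> (?V + k) / c * (F0 + M0)" if "x \<in> \<Omega>" for x
      proof -
        have "M0 * ?V + F0 * k \<le> (?V + k) * (F0 + M0)"
          using \<open>k \<ge> 0\<close> \<open>?V > 0\<close> F0(2) M0(2) by (simp add: algebra_simps)
        then have "norm (u x) * c \<le> (?V + k) * (F0 + M0)" using bound[OF that] by linarith
        then show ?thesis using \<open>c > 0\<close> by (simp add: field_simps)
      qed
      then have "AE x in lebesgue_on \<Omega>. ennreal (norm (u x)) \<le> ennreal ((?V + k) / c * (F0 + M0))"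
        by (intro AE_I2) (simp add: space_restrict_space ennreal_leI)
      moreover have "continuous_on \<Omega> u" using u(1) closure_subset by (rule continuous_on_subset)
      then have "(\<lambda>x. ennreal (norm (u x))) \<in> borel_measurable (lebesgue_on \<Omega>)"
        using \<Omega>(1) continuous_imp_measurable_on_sets_lebesgue[of \<Omega> u] by auto
      ultimately have "Linf_norm \<Omega> u \<le> ennreal ((?V + k) / c * (F0 + M0))"
        unfolding Linf_norm_def by (intro esssup_I)
      also have "\<dots> = ennreal ((?V + k) / c) * ennreal (F0 + M0)"
        using C_pos F0(2) M0(2) by (intro ennreal_mult) auto
      also have "ennreal (F0 + M0) = Lp_norm p \<Omega> E + ?M"
        using F0 M0 by simp
      finally show ?thesis by (simp add: k_def)
    qed
  qed
qed

end
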